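(* Let $\alpha(\boldsymbol x)>0$ and $\gamma(\boldsymbol x)\ge0$ for all $\boldsymbol x\in\Omega$. If a non-degenerate dual mesh configuration (e.g., non-degenerate Delaunay and Voronoi grids) is used, then the stiffness matrix $$\mathcal L_h=\mathcal D_V^{-1}\,\mathcal G^T\,\mathcal W\,\mathcal G\,E_{\boldsymbol x^D}+\mathcal D_{\gamma,\boldsymbol x^D},\qquad \mathcal W=\mathcal D_{\partial V}\,\mathcal D_{\alpha,\boldsymbol e^D}\,E_{\boldsymbol e^D}^{-1}\,\mathcal D_{\boldsymbol e^D}^{-1},$$ of the mimetic finite-difference scheme for the scalar convection-diffusion problem $-\operatorname{div}(\alpha\operatorname{grad}u+\boldsymbol\beta u)+\gamma u=f$ in $\Omega$, $u=0$ on $\partial\Omega$ (with the boundary nodes eliminated) is a non-singular M-matrix, i.e., it is monotone: if $f_h\ge0$ component-wise, then $\mathcal L_h^{-1}f_h\ge0$ component-wise.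
   Context: $\Omega\subset\mathbb R^3$ is a bounded polyhedral domain, $\alpha,\gamma$ are real-valued functions, $\boldsymbol\beta$ is a vector field, and $\boldsymbol\theta=\boldsymbol\beta/\alpha=\operatorname{grad}\varphi$ for a potential $\varphi$. Mesh. The primal mesh is a simplicial (Delaunay) mesh of $\Omega$ with nodes $\boldsymbol x^D_i$ and edges $\boldsymbol e^D_{ij}$ joining $\boldsymbol x^D_i$ and $\boldsymbol x^D_j$. The dual (e.g. Voronoi) mesh has one cell $V_i$ per primal node $\boldsymbol x^D_i$, one node per primal element, and one face $\partial V_{ij}$ per primal edge $\boldsymbol e^D_{ij}$, orthogonal to that edge. The configuration is non-degenerate if every dual node lies in the interior of its corresponding primal element, guaranteeing that all mesh measures (edge lengths, face areas, cell volumes of both meshes) are positive. Matrices (all integrals computed exactly; $⨍$ denotes the average integral): $\mathcal G$ is the primal edge-vertex signed incidence matrix (row of edge $\boldsymbol e^D_{ij}$, $i<j$, has $-1$ in column $i$, $+1$ in column $j$, zeros elsewhere) with the columns corresponding to boundary nodes eliminated; $\mathcal D_{\boldsymbol e^D}=\operatorname{diag}(|\boldsymbol e^D_{ij}|)$, $\mathcal D_{\partial V}=\operatorname{diag}(|\partial V_{ij}|)$, $\mathcal D_{\alpha,\boldsymbol e^D}=\operatorname{diag}\big(⨍_{\boldsymbol e^D_{ij}}\alpha\,ds\big)$, $E_{\boldsymbol e^D}=\operatorname{diag}\big(⨍_{\boldsymbol e^D_{ij}}e^{\varphi}\,ds\big)$ are indexed by primal edges; $\mathcal D_V=\operatorname{diag}(|V_i|)$,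 $E_{\boldsymbol x^D}=\operatorname{diag}(e^{\varphi(\boldsymbol x^D_i)})$, $\mathcal D_{\gamma,\boldsymbol x^D}=\operatorname{diag}(\gamma(\boldsymbol x^D_i))$ are indexed by primal nodes, with rows and columns of boundary nodes eliminated. A non-singular M-matrix is a matrix of the form $sI-B$ with $B\ge0$ entrywise and $s>\rho(B)$ ($\rho$ the spectral radius). *)

theory Defs
  imports
    "HOL-Analysis.Analysis"
    "Jordan_Normal_Form.Spectral_Radius"
    "Jordan_Normal_Form.Gauss_Jordan_Elimination"
begin

definition polygon :: "(real^3) set \<Rightarrow> bool" where
  "polygon P \<longleftrightarrow> polytope P \<and> aff_dim P = 2"

definition bounded_polyhedral_domain :: "(real^3) set \<Rightarrow> bool" where
  "bounded_polyhedral_domain \<Omega> \<longleftrightarrow>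
     open \<Omega> \<and> connected \<Omega> \<and> \<Omega> \<noteq> {} \<and> bounded \<Omega> \<and>
     (\<exists>\<P>. finite \<P> \<and> (\<forall>P\<in>\<P>. polygon P) \<and> frontier \<Omega> = \<Union>\<P>)"

text \<open>
  The simplicial complex contains the simplices of all dimensions. The two lists only fix an
  (arbitrary) numbering of its 0- and 1-simplices, i.e. of the rows and columns of the matrices;
  an edge is given by the numbers of its two end points.
\<close>

record mesh =
  complex :: "(real^3) set set"
  nodes :: "(real^3) list"
  edges :: "(nat \<times> nat) list"

abbreviation num_nodes :: "mesh \<Rightarrow> nat" where
  "num_nodes M \<equiv> length (nodes M)"

abbreviation num_edges :: "mesh \<Rightarrow> nat" where
  "num_edges M \<equiv> length (edges M)"

abbreviation node :: "mesh \<Rightarrow> nat \<Rightarrow> real^3" where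
  "node M i \<equiv> nodes M ! i"

definition elements :: "mesh \<Rightarrow> (real^3) set set" where
  "elements M = {T \<in> complex M. 3 simplex T}"

text \<open>
  The last condition says that the mesh resolves the boundary. It is automatic if
  \<open>\<Omega>\<close> is the interior of its closure, but also admits domains with slits.
\<close>

definition simplicial_mesh :: "(real^3) set \<Rightarrow> mesh \<Rightarrow> bool" where
  "simplicial_mesh \<Omega> M \<longleftrightarrow>
     simplicial_complex (complex M) \<and> \<Union>(complex M) = closure \<Omega> \<and>
     distinct (nodes M) \<and> set (nodes M) = {p. {p} \<in> complex M} \<and>
     distinct (edges M) \<and>
     set (edges M) = {(i, j). i < j \<and> j < num_nodes M \<and>
                        closed_segment (node M i) (node M j) \<in> complex M} \<and>
     (\<exists>\<B>\<subseteq>complex M. frontier \<Omega> = \<Union>\<B>)"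

definition interior_nodes :: "(real^3) set \<Rightarrow> mesh \<Rightarrow> nat list" where
  "interior_nodes \<Omega> M = filter (\<lambda>i. node M i \<notin> frontier \<Omega>) [0..<num_nodes M]"

definition polyhedral_set :: "(real^3) set \<Rightarrow> bool" where
  "polyhedral_set S \<longleftrightarrow> (\<exists>\<P>. finite \<P> \<and> (\<forall>P\<in>\<P>. polytope P) \<and> S = \<Union>\<P>)"

definition clipped_polyhedron :: "(real^3) set \<Rightarrow> (real^3) set \<Rightarrow> bool" where
  "clipped_polyhedron \<Omega> S \<longleftrightarrow> (\<exists>Q. polyhedron Q \<and> S = Q \<inter> closure \<Omega>)"

definition dual_face :: "(nat \<Rightarrow> (real^3) set) \<Rightarrow> nat \<times> nat \<Rightarrow> (real^3) set" where
  "dual_face V = (\<lambda>(i, j). V i \<inter> V j)"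

text \<open>
  A dual mesh is given by the dual nodes \<open>c T\<close> of the elements and the closed dual cells
  \<open>V i\<close> of the nodes. Cells of interior nodes, and faces dual to edges with an interior end
  point, are convex up to clipping at the boundary; for all other cells and faces convexity is not
  required, since the cell of a node at a reentrant corner or edge need not be convex. By duality
  of incidences, the node dual to an element is common to the cells dual to its vertices.
\<close>

definition dual_mesh ::
  "(real^3) set \<Rightarrow> mesh \<Rightarrow> ((real^3) set \<Rightarrow> real^3) \<Rightarrow> (nat \<Rightarrow> (real^3) set) \<Rightarrow> bool" where
  "dual_mesh \<Omega> M c V \<longleftrightarrow>
     (\<forall>i<num_nodes M. polyhedral_set (V i)) \<and>
     (\<Union>i<num_nodes M. V i) = closure \<Omega> \<and>
     (\<forall>i<num_nodes M. \<forall>j<num_nodes M. i \<noteq> j \<longrightarrow> interior (V i) \<inter> interior (V j) = {}) \<and>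
     (\<forall>i\<in>set (interior_nodes \<Omega> M). clipped_polyhedron \<Omega> (V i)) \<and>
     (\<forall>(i, j)\<in>set (edges M). i \<in> set (interior_nodes \<Omega> M) \<or> j \<in> set (interior_nodes \<Omega> M) \<longrightarrow>
        clipped_polyhedron \<Omega> (dual_face V (i, j))) \<and>
     (\<forall>T\<in>elements M. \<forall>i<num_nodes M. node M i \<in> T \<longrightarrow> c T \<in> V i) \<and>
     (\<forall>(i, j)\<in>set (edges M). \<forall>p\<in>dual_face V (i, j). \<forall>q\<in>dual_face V (i, j).
        inner (p - q) (node M j - node M i) = 0)"

definition nondegenerate :: "mesh \<Rightarrow> ((real^3) set \<Rightarrow> real^3) \<Rightarrow> bool" where
  "nondegenerate M c \<longleftrightarrow> (\<forall>T\<in>elements M. c T \<in> interior T)"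

text \<open>
  The standard example, a Delaunay mesh with the Voronoi cells of its nodes: \<open>c T\<close> is the
  centre of a sphere through the vertices of \<open>T\<close> with no node of the mesh inside.
\<close>

definition delaunay :: "mesh \<Rightarrow> ((real^3) set \<Rightarrow> real^3) \<Rightarrow> bool" where
  "delaunay M c \<longleftrightarrow>
     (\<forall>T\<in>elements M. \<exists>r. \<forall>i<num_nodes M. r \<le> dist (c T) (node M i) \<and>
        (node M i \<in> T \<longrightarrow> dist (c T) (node M i) = r))"

definition voronoi_cell :: "(real^3) set \<Rightarrow> mesh \<Rightarrow> nat \<Rightarrow> (real^3) set" where
  "voronoi_cell \<Omega> M i =
     {p \<in> closure \<Omega>. \<forall>j<num_nodes M. dist p (node M i) \<le> dist p (node M j)}"

lemma voronoi_dual_mesh: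
  assumes mesh: "simplicial_mesh \<Omega> M" and del: "delaunay M c" and nd: "nondegenerate M c"
  shows "dual_mesh \<Omega> M c (voronoi_cell \<Omega> M)"
proof -
  let ?V = "voronoi_cell \<Omega> M" and ?N = "num_nodes M" and ?x = "node M"
  have half: "dist p a \<le> dist p b \<longleftrightarrow> inner (2 *\<^sub>R (b - a)) p \<le> inner b b - inner a a"
    for p a b :: "real^3"
    unfolding dist_norm norm_le
    by (simp add: inner_diff_left inner_diff_right inner_commute algebra_simps)
  define Q where "Q i = \<Inter>((\<lambda>j. {p. inner (2 *\<^sub>R (?x j - ?x i)) p
      \<le> inner (?x j) (?x j) - inner (?x i) (?x i)}) ` {..<?N})" for i
  have Q: "polyhedron (Q i)" for i
    unfolding Q_def by (rule polyhedron_Inter) (auto intro: polyhedron_halfspace_le simp del: inner_scaleR_left)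
  have VQ: "?V i = Q i \<inter> closure \<Omega>" for i
    unfolding voronoi_cell_def Q_def half by auto
  have U: "closure \<Omega> = \<Union>(complex M)" and fin: "finite (complex M)"
    and sim: "\<And>S. S \<in> complex M \<Longrightarrow> polytope S"
    using mesh unfolding simplicial_mesh_def simplicial_complex_def
    by (auto intro: simplex_imp_polytope)
  have c1: "polyhedral_set (?V i)" for i
    unfolding polyhedral_set_def
  proof (intro exI conjI ballI)
    show "finite ((\<inter>) (Q i) ` complex M)" using fin by simp
    show "?V i = \<Union>((\<inter>) (Q i) ` complex M)" unfolding VQ U by auto
    fix P assume "P \<in> (\<inter>) (Q i) ` complex M"
    then show "polytope P"
      using Q sim polytope_Int_polyhedron by (metis (no_types, lifting) Int_commute imageE)
  qed
  have c2: "(\<Union>i<?N. ?V i) = closure \<Omega>"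
  proof -
    have "\<exists>i<?N. p \<in> ?V i" if p: "p \<in> closure \<Omega>" for p
    proof -
      obtain S where S: "S \<in> complex M" "p \<in> S" using p U by auto
      then obtain v where "v extreme_point_of S"
        using extreme_point_exists_convex[of S] sim[OF S(1)]
        by (metis empty_iff polytope_imp_compact polytope_imp_convex)
      then have "{v} \<in> complex M"
        using S mesh unfolding simplicial_mesh_def simplicial_complex_def
        by (metis face_of_singleton)
      then have "?N > 0" using mesh unfolding simplicial_mesh_def
        by (metis empty_iff empty_set length_greater_0_conv mem_Collect_eq)
      then have ne: "{..<?N} \<noteq> {}" by auto
      obtain i where "i \<in> {..<?N}" "\<And>j. j \<in> {..<?N} \<Longrightarrow> dist p (?x i) \<le> dist p (?x j)"
        using ex_min_if_finite[of "(\<lambda>i. dist p (?x i)) ` {..<?N}"] ne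
        by (fastforce simp: not_less)
      then show ?thesis using p unfolding voronoi_cell_def by auto
    qed
    then show ?thesis unfolding voronoi_cell_def by auto
  qed
  have c3: "interior (?V i) \<inter> interior (?V j) = {}" if ij: "i < ?N" "j < ?N" "i \<noteq> j" for i j
  proof (rule ccontr)
    define a where "a = 2 *\<^sub>R (?x j - ?x i)"
    define b where "b = inner (?x j) (?x j) - inner (?x i) (?x i)"
    have "?x i \<noteq> ?x j" using ij mesh unfolding simplicial_mesh_def by (simp add: nth_eq_iff_index_eq)
    then have a: "a \<noteq> 0" unfolding a_def by simp
    have sub: "?V i \<inter> ?V j \<subseteq> {p. inner a p = b}"
    proof
      fix p assume p: "p \<in> ?V i \<inter> ?V j"
      then have "dist p (?x i) = dist p (?x j)"
        using ij unfolding voronoi_cell_def by force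
      then show "p \<in> {p. inner a p = b}"
        using half[of p "?x i" "?x j"] half[of p "?x j" "?x i"] unfolding a_def b_def
        by (simp add: inner_diff_left)
    qed
    assume "interior (?V i) \<inter> interior (?V j) \<noteq> {}"
    then have "interior {p. inner a p = b} \<noteq> {}"
      using interior_mono[OF sub] by (auto simp: interior_Int)
    then show False using a by (simp add: interior_hyperplane)
  qed
  have c4: "clipped_polyhedron \<Omega> (?V i)" for i
    unfolding clipped_polyhedron_def using VQ Q by blast
  have c5: "clipped_polyhedron \<Omega> (dual_face ?V (i, j))" for i j
    unfolding clipped_polyhedron_def dual_face_def
    by (rule exI[of _ "Q i \<inter> Q j"]) (use VQ Q polyhedron_Int in auto)
  have c6: "c T \<in> ?V i" if T: "T \<in> elements M" "i < ?N" "?x i \<in> T" for T i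
  proof -
    have "c T \<in> T" using nd T interior_subset unfolding nondegenerate_def by blast
    then have "c T \<in> closure \<Omega>" using T U unfolding elements_def by auto
    then show ?thesis using T del unfolding delaunay_def voronoi_cell_def by fastforce
  qed
  have c7: "inner (p - q) (?x j - ?x i) = 0"
    if ij: "(i, j) \<in> set (edges M)" and p: "p \<in> dual_face ?V (i, j)"
      and q: "q \<in> dual_face ?V (i, j)" for i j p q
  proof -
    have N: "i < ?N" "j < ?N" using ij mesh unfolding simplicial_mesh_def by auto
    have *: "inner (2 *\<^sub>R (?x j - ?x i)) u = inner (?x j) (?x j) - inner (?x i) (?x i)"
      if "u \<in> dual_face ?V (i, j)" for u
    proof -
      have "dist u (?x i) = dist u (?x j)"
        using that N unfolding dual_face_def voronoi_cell_def by force
      then show ?thesis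
        using half[of u "?x i" "?x j"] half[of u "?x j" "?x i"] by (simp add: inner_diff_left)
    qed
    show ?thesis using *[OF p] *[OF q] by (simp add: inner_diff_right inner_diff_left inner_commute)
  qed
  show ?thesis
    unfolding dual_mesh_def
  proof (intro conjI)
    show "\<forall>i<?N. polyhedral_set (?V i)" using c1 by blast
    show "(\<Union>i<?N. ?V i) = closure \<Omega>" by (rule c2)
    show "\<forall>i<?N. \<forall>j<?N. i \<noteq> j \<longrightarrow> interior (?V i) \<inter> interior (?V j) = {}"
      using c3 by blast
    show "\<forall>i\<in>set (interior_nodes \<Omega> M). clipped_polyhedron \<Omega> (?V i)" using c4 by blast
    show "\<forall>T\<in>elements M. \<forall>i<?N. ?x i \<in> T \<longrightarrow> c T \<in> ?V i" using c6 by blast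
  qed (use c5 c7 in auto)
qed

definition edge_length :: "mesh \<Rightarrow> nat \<times> nat \<Rightarrow> real" where
  "edge_length M = (\<lambda>(i, j). dist (node M i) (node M j))"

definition edge_point :: "mesh \<Rightarrow> nat \<times> nat \<Rightarrow> real \<Rightarrow> real^3" where
  "edge_point M = (\<lambda>(i, j) s. node M i + (s / edge_length M (i, j)) *\<^sub>R (node M j - node M i))"

definition integrable_on_edge :: "mesh \<Rightarrow> (real^3 \<Rightarrow> real) \<Rightarrow> nat \<times> nat \<Rightarrow> bool" where
  "integrable_on_edge M f e \<longleftrightarrow> (\<lambda>s. f (edge_point M e s)) integrable_on {0..edge_length M e}"

definition edge_average :: "mesh \<Rightarrow> (real^3 \<Rightarrow> real) \<Rightarrow> nat \<times> nat \<Rightarrow> real" where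
  "edge_average M f e =
     integral {0..edge_length M e} (\<lambda>s. f (edge_point M e s)) / edge_length M e"

text \<open>
  Two-dimensional Lebesgue measure of a subset of a plane, transported by an isometric
  parametrization of the plane; it does not depend on the choice of the parametrization.
\<close>

definition planar_area :: "(real^3) set \<Rightarrow> real" where
  "planar_area S =
     (let f = (SOME f :: real^2 \<Rightarrow> real^3. (\<forall>u v. dist (f u) (f v) = dist u v) \<and> S \<subseteq> range f)
      in measure lebesgue (f -` S))"

definition edge_diag :: "mesh \<Rightarrow> (nat \<times> nat \<Rightarrow> real) \<Rightarrow> real mat" where
  "edge_diag M d = mat_diag (num_edges M) (\<lambda>k. d (edges M ! k))"

definition node_diag :: "(real^3) set \<Rightarrow> mesh \<Rightarrow> (nat \<Rightarrow> real) \<Rightarrow> real mat" where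
  "node_diag \<Omega> M d =
     mat_diag (length (interior_nodes \<Omega> M)) (\<lambda>l. d (interior_nodes \<Omega> M ! l))"

definition incidence_mat :: "(real^3) set \<Rightarrow> mesh \<Rightarrow> real mat" where
  "incidence_mat \<Omega> M = Matrix.mat (num_edges M) (length (interior_nodes \<Omega> M))
     (\<lambda>(k, l). let (i, j) = edges M ! k; n = interior_nodes \<Omega> M ! l
               in if n = i then - 1 else if n = j then 1 else 0)"

abbreviation minv :: "real mat \<Rightarrow> real mat" where
  "minv A \<equiv> the (mat_inverse A)"

definition weight_mat ::
  "mesh \<Rightarrow> (nat \<Rightarrow> (real^3) set) \<Rightarrow> (real^3 \<Rightarrow> real) \<Rightarrow> (real^3 \<Rightarrow> real) \<Rightarrow> real mat" where
  "weight_mat M V \<alpha> \<phi> =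
     edge_diag M (\<lambda>e. planar_area (dual_face V e)) *
     edge_diag M (edge_average M \<alpha>) *
     minv (edge_diag M (edge_average M (\<lambda>x. exp (\<phi> x)))) *
     minv (edge_diag M (edge_length M))"

definition stiffness_mat ::
  "(real^3) set \<Rightarrow> mesh \<Rightarrow> (nat \<Rightarrow> (real^3) set) \<Rightarrow>
   (real^3 \<Rightarrow> real) \<Rightarrow> (real^3 \<Rightarrow> real) \<Rightarrow> (real^3 \<Rightarrow> real) \<Rightarrow> real mat" where
  "stiffness_mat \<Omega> M V \<alpha> \<phi> \<gamma> =
     minv (node_diag \<Omega> M (\<lambda>i. measure lebesgue (V i))) *
       transpose_mat (incidence_mat \<Omega> M) * weight_mat M V \<alpha> \<phi> * incidence_mat \<Omega> M *
       node_diag \<Omega> M (\<lambda>i. exp (\<phi> (node M i))) +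
     node_diag \<Omega> M (\<lambda>i. \<gamma> (node M i))"

definition nonsingular_M_matrix :: "real mat \<Rightarrow> bool" where
  "nonsingular_M_matrix A \<longleftrightarrow>
     (\<exists>n s B. B \<in> carrier_mat n n \<and> (\<forall>i<n. \<forall>j<n. 0 \<le> B $$ (i, j)) \<and>
        A = s \<cdot>\<^sub>m 1\<^sub>m n - B \<and> spectral_radius (map_mat complex_of_real B) < s)"

definition monotone_mat :: "real mat \<Rightarrow> bool" where
  "monotone_mat A \<longleftrightarrow> invertible_mat A \<and>
     (\<forall>f \<in> carrier_vec (dim_row A). 0\<^sub>v (dim_row A) \<le> f \<longrightarrow>
        0\<^sub>v (dim_row A) \<le> minv A *\<^sub>v f)"

end

theory Submission
  imports Defs
begin

text \<open>
  Write \<open>L\<close> for the stiffness matrix and \<open>w\<close> for the diagonal entries of the weight matrix. If the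
  weights and the cell volumes are positive, then \<open>L\<close> is a Z-matrix: off the diagonal only the
  edge between the two nodes contributes, with the product of the two opposite incidence signs.
  Moreover \<open>L v \<ge> 0\<close> for the positive vector \<open>v = exp (- \<phi>)\<close>: the factor \<open>exp \<phi>\<close> turns \<open>v\<close> into the
  constant vector \<open>1\<close>, and the incidence matrix maps \<open>1\<close> to a vector that vanishes on all edges
  between interior nodes and has, on an edge to the boundary, the sign of its interior end point.

  Away from the boundary \<open>L v \<ge> 0\<close> can be an equality, for example if \<open>\<gamma> = 0\<close>, so something must
  connect every node to the boundary. Instead of irreducibility the proof uses a height, a nonzero linear
  function of the position. The tetrahedra around an interior node fill a neighbourhood of it,
  hence one of the adjacent nodes is strictly higher (\<open>interior_node_higher_neighbour\<close>). Either this
  node lies on the boundary, and the row of \<open>L v\<close> is positive, or it is an interior node with a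
  nonzero entry in the row. This ascent replaces irreducibility in a discrete maximum principle
  (\<open>chained_Z_matrix_inverse_nonneg\<close>): \<open>L x \<ge> 0\<close> implies \<open>x \<ge> 0\<close>. A Z-matrix with this property is
  invertible with nonnegative inverse, and it is a nonsingular M-matrix: with \<open>L = s I - B\<close>, an
  eigenvector \<open>z\<close> of \<open>B\<close> whose eigenvalue had modulus at least \<open>s\<close> would satisfy \<open>L (- |z|) \<ge> 0\<close>,
  hence \<open>z = 0\<close>.

  The geometric part is the positivity of the volumes of the cells and of the areas of the faces,
  about which one only knows convexity (up to clipping), orthogonality and which dual nodes they
  contain. Let \<open>T\<close> be an element with an interior node \<open>a\<close> as a vertex. Each facet of \<open>T\<close> through \<open>a\<close>
  is shared with another element \<open>T'\<close>. The difference \<open>c T' - c T\<close> is nonzero, because the dual nodes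
  lie in disjoint interiors, and orthogonal to the facet, because it is orthogonal to its edges. The
  three vectors obtained in this way are biorthogonal to the edge vectors of \<open>T\<close> at \<open>a\<close> and
  therefore independent (\<open>biorthogonal_family_independent\<close>). So the cell of \<open>a\<close> contains the
  vertices of a nondegenerate tetrahedron, and the face dual to an edge \<open>a b\<close>, which contains the
  dual nodes belonging to the two facets through that edge, contains those of a nondegenerate
  triangle. Since \<open>c T\<close> is an interior point of \<open>T\<close>, clipping by \<open>\<Omega>\<close> does no harm near \<open>c T\<close>.
\<close>

section \<open>Z-matrices with a maximum principle\<close>

text \<open>
  A maximum principle for \<open>x\<close> relative to \<open>v\<close>. At an index where the ratio \<open>x / v\<close> attains a negative
  minimum, \<open>A x \<ge> 0\<close> forces \<open>A v = 0\<close> in that row and equal ratios at all indices with a nonzero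
  entry. Choosing the minimizer with the largest value of \<open>h\<close> contradicts the chain condition.
\<close>

lemma chained_Z_matrix_inverse_nonneg:
  fixes A :: "real mat" and v h :: "nat \<Rightarrow> real"
  assumes A: "A \<in> carrier_mat n n"
    and off: "\<And>i j. i < n \<Longrightarrow> j < n \<Longrightarrow> i \<noteq> j \<Longrightarrow> A $$ (i, j) \<le> 0"
    and v: "\<And>i. i < n \<Longrightarrow> 0 < v i"
    and rows: "\<And>i. i < n \<Longrightarrow> 0 \<le> (\<Sum>j<n. A $$ (i, j) * v j)"
    and chain: "\<And>i. i < n \<Longrightarrow> 0 < (\<Sum>j<n. A $$ (i, j) * v j) \<or> (\<exists>j<n. A $$ (i, j) < 0 \<and> h i < h j)"
    and x: "x \<in> carrier_vec n" and Ax: "0\<^sub>v n \<le> A *\<^sub>v x"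
  shows "0\<^sub>v n \<le> x"
proof (rule ccontr)
  define y where "y = (\<lambda>j. x $ j / v j)"
  have xy: "x $ j = v j * y j" if "j < n" for j
    using v[OF that] by (simp add: y_def)
  assume "\<not> 0\<^sub>v n \<le> x"
  then obtain k where k: "k < n" "x $ k < 0"
    using x by (auto simp: less_eq_vec_def)
  define m where "m = Min (y ` {..<n})"
  have m_le: "m \<le> y j" if "j < n" for j
    using that by (simp add: m_def)
  have "y k < 0" using k v[of k] by (simp add: y_def divide_neg_pos)
  then have m0: "m < 0" using m_le[OF k(1)] by simp
  define S where "S = {i. i < n \<and> y i = m}"
  have "m \<in> y ` {..<n}" unfolding m_def using k by (intro Min_in) auto
  then have S: "finite S" "S \<noteq> {}" by (auto simp: S_def)
  have "Max (h ` S) \<in> h ` S" using S by (intro Max_in) auto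
  then obtain i where i: "i \<in> S" "h i = Max (h ` S)" by auto
  have top: "h j \<le> h i" if "j \<in> S" for j
    using that S i by simp
  have i_n: "i < n" and y_i: "y i = m" using i by (auto simp: S_def)
  let ?d = "\<lambda>j. A $$ (i, j) * v j * (y j - m)"
  have d: "?d j \<le> 0" if "j < n" for j
  proof (cases "j = i")
    case False
    then show ?thesis
      using off[OF i_n that] m_le[OF that] v[OF that]
      by (intro mult_nonpos_nonneg) auto
  qed (simp add: y_i)
  have "0 \<le> (A *\<^sub>v x) $ i"
    using Ax A i_n by (auto simp: less_eq_vec_def)
  also have "(A *\<^sub>v x) $ i = (\<Sum>j<n. A $$ (i, j) * x $ j)"
    using A x i_n by (simp add: scalar_prod_def atLeast0LessThan)
  also have "\<dots> = (\<Sum>j<n. m * (A $$ (i, j) * v j) + ?d j)"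
    by (intro sum.cong) (auto simp: xy algebra_simps)
  also have "\<dots> = m * (\<Sum>j<n. A $$ (i, j) * v j) + (\<Sum>j<n. ?d j)"
    by (simp add: sum.distrib sum_distrib_left)
  (* The minimum m is split off: the first part is nonpositive since m < 0 and A v \<ge> 0, the
     second since the off-diagonal entries are nonpositive and m is minimal. *)
  finally have bal: "0 \<le> m * (\<Sum>j<n. A $$ (i, j) * v j) + (\<Sum>j<n. ?d j)" .
  have "(\<Sum>j<n. ?d j) \<le> 0" using d by (intro sum_nonpos) auto
  moreover have "m * (\<Sum>j<n. A $$ (i, j) * v j) \<le> 0"
    using m0 rows[OF i_n] by (simp add: mult_nonpos_nonneg)
  ultimately have zero: "m * (\<Sum>j<n. A $$ (i, j) * v j) = 0" "(\<Sum>j<n. ?d j) = 0"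
    using bal by linarith+
  then obtain j where j: "j < n" "A $$ (i, j) < 0" "h i < h j"
    using chain[OF i_n] m0 by auto
  have "(\<Sum>j<n. - ?d j) = 0" using zero(2) by (simp add: sum_negf)
  then have "?d j = 0"
    using d j(1) by (subst (asm) sum_nonneg_eq_0_iff) auto
  then have "j \<in> S" using j v[OF j(1)] by (simp add: S_def)
  with top[of j] j(3) show False by simp
qed

lemma inverse_nonneg_imp_det_nonzero:
  fixes A :: "real mat"
  assumes A: "A \<in> carrier_mat n n"
    and pos: "\<And>x. x \<in> carrier_vec n \<Longrightarrow> 0\<^sub>v n \<le> A *\<^sub>v x \<Longrightarrow> 0\<^sub>v n \<le> x"
  shows "det A \<noteq> 0"
proof
  assume "det A = 0"
  then obtain x where x: "x \<in> carrier_vec n" "x \<noteq> 0\<^sub>v n" "A *\<^sub>v x = 0\<^sub>v n"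
    using det_0_iff_vec_prod_zero_field[OF A] by auto
  have "A *\<^sub>v (- x) = - (A *\<^sub>v x)"
    using A x(1) by (intro eq_vecI) auto
  then have "A *\<^sub>v (- x) = 0\<^sub>v n"
    using x(3) by (auto intro!: eq_vecI)
  then have "0\<^sub>v n \<le> x" "0\<^sub>v n \<le> - x"
    using pos[of x] pos[of "- x"] x(1,3) by simp_all
  then have "x = 0\<^sub>v n"
    using x(1) by (intro eq_vecI) (auto simp: less_eq_vec_def, fastforce)
  with x(2) show False ..
qed

text \<open>
  The hypothesis on the determinant excludes the result \<open>None\<close> of the inversion algorithm, for
  which \<open>minv\<close> is unspecified.
\<close>

lemma minv_inverse:
  fixes A :: "real mat"
  assumes A: "A \<in> carrier_mat n n" and det: "det A \<noteq> 0"
  shows "A * minv A = 1\<^sub>m n" "minv A * A = 1\<^sub>m n" "minv A \<in> carrier_mat n n"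
proof -
  obtain B where "mat_inverse A = Some B"
    using mat_inverse(1)[OF A, of "()"] det_non_zero_imp_unit[OF A det, of "()"]
    by (cases "mat_inverse A") auto
  with mat_inverse(2)[OF A this]
  show "A * minv A = 1\<^sub>m n" "minv A * A = 1\<^sub>m n" "minv A \<in> carrier_mat n n" by auto
qed

lemma monotone_matI:
  fixes A :: "real mat"
  assumes A: "A \<in> carrier_mat n n"
    and pos: "\<And>x. x \<in> carrier_vec n \<Longrightarrow> 0\<^sub>v n \<le> A *\<^sub>v x \<Longrightarrow> 0\<^sub>v n \<le> x"
  shows "monotone_mat A"
proof -
  note inv = minv_inverse[OF A inverse_nonneg_imp_det_nonzero[OF A pos]]
  have "invertible_mat A"
    unfolding invertible_mat_def inverts_mat_def using A inv by auto
  moreover have "0\<^sub>v n \<le> minv A *\<^sub>v f" if f: "f \<in> carrier_vec n" "0\<^sub>v n \<le> f" for f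
  proof (rule pos)
    show "minv A *\<^sub>v f \<in> carrier_vec n" using inv(3) f by auto
    have "A *\<^sub>v (minv A *\<^sub>v f) = A * minv A *\<^sub>v f"
      using A inv(3) f(1) by (simp add: assoc_mult_mat_vec)
    then show "0\<^sub>v n \<le> A *\<^sub>v (minv A *\<^sub>v f)" using inv f by simp
  qed
  ultimately show ?thesis unfolding monotone_mat_def using A by auto
qed

text \<open>
  Take \<open>s\<close> above all diagonal entries, so that \<open>B = s I - A\<close> is nonnegative, and let \<open>z\<close> be an
  eigenvector for an eigenvalue \<open>\<mu>\<close> of \<open>B\<close> of largest modulus. The triangle inequality gives
  \<open>|\<mu>| |z| \<le> B |z|\<close>; if \<open>|\<mu>| \<ge> s\<close>, then \<open>A (- |z|) \<ge> 0\<close>, so \<open>- |z| \<ge> 0\<close>, which is impossible.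
\<close>

lemma nonsingular_M_matrixI:
  fixes A :: "real mat"
  assumes A: "A \<in> carrier_mat n n"
    and off: "\<And>i j. i < n \<Longrightarrow> j < n \<Longrightarrow> i \<noteq> j \<Longrightarrow> A $$ (i, j) \<le> 0"
    and pos: "\<And>x. x \<in> carrier_vec n \<Longrightarrow> 0\<^sub>v n \<le> A *\<^sub>v x \<Longrightarrow> 0\<^sub>v n \<le> x"
  shows "nonsingular_M_matrix A"
proof -
  define s0 where "s0 = (\<Sum>i<n. \<bar>A $$ (i, i)\<bar>)"
  (* For n = 0 the spectral radius is the maximum of the empty set, an unspecified number; since
     every s represents the empty matrix, one above that number can be chosen. *)
  define s where "s = (if n = 0 then spectral_radius (map_mat complex_of_real (0\<^sub>m 0 0)) + 1 else s0)"
  define B where "B = s \<cdot>\<^sub>m 1\<^sub>m n - A"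
  have B: "B \<in> carrier_mat n n" unfolding B_def by (rule minus_carrier_mat[OF A])
  have B_ix: "B $$ (i, j) = (if i = j then s else 0) - A $$ (i, j)" if "i < n" "j < n" for i j
    using that A by (simp add: B_def)
  have diag: "A $$ (i, i) \<le> s" if "i < n" for i
  proof -
    have "\<bar>A $$ (i, i)\<bar> \<le> s0" unfolding s0_def using that by (intro member_le_sum) auto
    then show ?thesis using that by (simp add: s_def)
  qed
  have B_nonneg: "0 \<le> B $$ (i, j)" if "i < n" "j < n" for i j
    using that diag off by (cases "i = j") (auto simp: B_ix)
  have AB: "A = s \<cdot>\<^sub>m 1\<^sub>m n - B"
    using A B by (intro eq_matI) (auto simp: B_ix)
  have "spectral_radius (map_mat complex_of_real B) < s"
  proof (cases "n = 0")
    case True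
    then have "B = 0\<^sub>m 0 0" using B by (intro eq_matI) auto
    with True show ?thesis by (simp add: s_def)
  next
    case False
    let ?C = "map_mat complex_of_real B"
    have C: "?C \<in> carrier_mat n n" using B by simp
    obtain \<mu> where "\<mu> \<in> spectrum ?C" and rho: "spectral_radius ?C = cmod \<mu>"
      using spectral_radius_mem_max(1)[OF C] False by auto
    then obtain z where z: "z \<in> carrier_vec n" "z \<noteq> 0\<^sub>v n" "?C *\<^sub>v z = \<mu> \<cdot>\<^sub>v z"
      using C unfolding spectrum_def eigenvalue_def eigenvector_def by auto
    define a where "a = Matrix.vec n (\<lambda>i. - cmod (z $ i))"
    have a: "a \<in> carrier_vec n" by (simp add: a_def)
    show ?thesis
    proof (rule ccontr)
      assume "\<not> spectral_radius ?C < s"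
      then have large: "s \<le> cmod \<mu>" using rho by simp
      have "0 \<le> (A *\<^sub>v a) $ i" if i: "i < n" for i
      proof -
        have "(?C *\<^sub>v z) $ i = (\<Sum>j<n. of_real (B $$ (i, j)) * z $ j)"
          using C z(1) i B by (simp add: scalar_prod_def atLeast0LessThan)
        moreover have "(?C *\<^sub>v z) $ i = \<mu> * z $ i"
          using z i by simp
        ultimately have "cmod (\<mu> * z $ i) = cmod (\<Sum>j<n. of_real (B $$ (i, j)) * z $ j)"
          by simp
        then have "cmod \<mu> * cmod (z $ i) = cmod (\<Sum>j<n. of_real (B $$ (i, j)) * z $ j)"
          by (simp add: norm_mult)
        also have "\<dots> \<le> (\<Sum>j<n. B $$ (i, j) * cmod (z $ j))"
          using B_nonneg[OF i] by (intro sum_norm_le) (simp add: norm_mult)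
        finally have le: "s * cmod (z $ i) \<le> (\<Sum>j<n. B $$ (i, j) * cmod (z $ j))"
          using mult_right_mono[OF large, of "cmod (z $ i)"] by simp
        have "(A *\<^sub>v a) $ i = (\<Sum>j<n. A $$ (i, j) * a $ j)"
          using A a i by (simp add: scalar_prod_def atLeast0LessThan)
        also have "\<dots> = (\<Sum>j<n. B $$ (i, j) * cmod (z $ j) - (if i = j then s * cmod (z $ j) else 0))"
          using i by (intro sum.cong) (auto simp: a_def B_ix algebra_simps)
        also have "\<dots> = (\<Sum>j<n. B $$ (i, j) * cmod (z $ j)) - s * cmod (z $ i)"
          using i by (simp add: sum_subtractf)
        finally show ?thesis using le by simp
      qed
      then have "0\<^sub>v n \<le> A *\<^sub>v a" using A by (auto simp: less_eq_vec_def)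
      then have "0\<^sub>v n \<le> a" by (rule pos[OF a])
      then have "z = 0\<^sub>v n"
        using z(1) by (intro eq_vecI) (auto simp: less_eq_vec_def a_def)
      with z(2) show False ..
    qed
  qed
  then show ?thesis unfolding nonsingular_M_matrix_def using B B_nonneg AB by blast
qed

section \<open>Convex sets with interior points and their measure\<close>

text \<open>
  The vectors \<open>n b\<close> are normals of the facets through \<open>a\<close> of the simplex with vertices \<open>C\<close>. Each
  \<open>n b\<close> is orthogonal to all edge vectors at \<open>a\<close> but \<open>b - a\<close>. It cannot be orthogonal to this one too,
  as the edge vectors span the space. So \<open>b - a\<close> separates \<open>n b\<close> from the span of the others.
\<close>

lemma biorthogonal_family_independent:
  fixes C :: "'a::euclidean_space set" and n :: "'a \<Rightarrow> 'a"
  assumes C: "\<not> affine_dependent C" "card C = DIM('a) + 1" and a: "a \<in> C"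
    and n0: "\<And>b. b \<in> C - {a} \<Longrightarrow> n b \<noteq> 0"
    and n: "\<And>b x. b \<in> C - {a} \<Longrightarrow> x \<in> C - {b} \<Longrightarrow> inner (n b) (x - a) = 0"
  shows "independent (n ` (C - {a}))" "inj_on n (C - {a})"
proof -
  have fin: "finite C" using C(2) by (metis Suc_eq_plus1 card.infinite nat.distinct(1))
  let ?D = "(\<lambda>x. x - a) ` (C - {a})"
  have indD: "independent ?D"
    using affine_dependent_iff_dependent2[OF a] C(1) by simp
  have "card ?D = DIM('a)"
    using C(2) a fin by (subst card_image) (auto simp: inj_on_def)
  then have span: "span ?D = UNIV"
    using card_ge_dim_independent[of ?D UNIV] indD by fastforce
  have nb: "inner (n b) (b - a) \<noteq> 0" if b: "b \<in> C - {a}" for b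
  proof
    assume 0: "inner (n b) (b - a) = 0"
    have "Linear_Algebra.orthogonal (n b) (n b)"
    proof (rule orthogonal_to_span)
      show "n b \<in> span ?D" using span by simp
      fix y assume "y \<in> ?D"
      then obtain x where "x \<in> C" "y = x - a" by blast
      then show "Linear_Algebra.orthogonal (n b) y"
        using 0 n[OF b, of x] by (cases "x = b") (auto simp: Linear_Algebra.orthogonal_def)
    qed
    then show False using n0[OF b] by (simp add: Linear_Algebra.orthogonal_def)
  qed
  show inj: "inj_on n (C - {a})"
  proof (rule inj_onI, rule ccontr)
    fix b b' assume b: "b \<in> C - {a}" "b' \<in> C - {a}" "n b = n b'" "b \<noteq> b'"
    then have "inner (n b') (b - a) = 0" by (intro n) auto
    with nb[OF b(1)] b(3) show False by simp
  qed
  show "independent (n ` (C - {a}))"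
  proof
    assume "dependent (n ` (C - {a}))"
    then obtain b where b: "b \<in> C - {a}" and sp: "n b \<in> span (n ` (C - {a}) - {n b})"
      by (auto simp: dependent_def)
    have "Linear_Algebra.orthogonal (b - a) (n b)"
    proof (rule orthogonal_to_span[OF sp])
      fix y assume "y \<in> n ` (C - {a}) - {n b}"
      then obtain b' where b': "b' \<in> C - {a}" "y = n b'" "b' \<noteq> b" by auto
      then have "inner (n b') (b - a) = 0" using b by (intro n) auto
      then show "Linear_Algebra.orthogonal (b - a) y" using b' by (simp add: Linear_Algebra.orthogonal_def inner_commute)
    qed
    then show False using nb[OF b] by (simp add: Linear_Algebra.orthogonal_def inner_commute)
  qed
qed

lemma interior_convex_of_independent:
  fixes K :: "'a::euclidean_space set"
  assumes K: "convex K" and p: "p \<in> K" and N: "independent N" "card N = DIM('a)"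
    and pn: "\<And>n. n \<in> N \<Longrightarrow> p + n \<in> K"
  shows "interior K \<noteq> {}"
proof
  assume "interior K = {}"
  then obtain w d where w: "w \<noteq> 0" "K \<subseteq> {x. inner w x = d}"
    using empty_interior_subset_hyperplane[OF K] by blast
  have "UNIV \<subseteq> span N"
    using N by (intro card_ge_dim_independent) auto
  then have w_span: "w \<in> span N" by blast
  have "Linear_Algebra.orthogonal w w"
  proof (rule orthogonal_to_span[OF w_span])
    fix n assume "n \<in> N"
    then have "inner w (p + n) = d" "inner w p = d" using pn p w(2) by blast+
    then show "Linear_Algebra.orthogonal w n" by (simp add: Linear_Algebra.orthogonal_def inner_add_right)
  qed
  with w(1) show False by (simp add: Linear_Algebra.orthogonal_def)
qed

text \<open>
  The interior of a convex body is dense in it, so it reaches every neighbourhood \<open>U\<close> of \<open>p\<close>, even if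
  \<open>p\<close> is a boundary point of \<open>K\<close>.
\<close>

lemma interior_convex_Int_open:
  fixes K :: "'a::euclidean_space set"
  assumes K: "convex K" "interior K \<noteq> {}" and U: "open U" and p: "p \<in> K" "p \<in> U"
  shows "interior (K \<inter> U) \<noteq> {}"
proof -
  have "p \<in> U \<inter> closure (interior K)"
    using convex_closure_interior[OF K] p closure_subset by auto
  then have "U \<inter> interior K \<noteq> {}"
    using open_Int_closure_eq_empty[OF U] by blast
  then show ?thesis using U by (simp add: interior_Int interior_open Int_commute)
qed

lemma measure_pos_of_interior:
  fixes S :: "'a::euclidean_space set"
  assumes "compact S" "interior S \<noteq> {}"
  shows "0 < measure lebesgue S"
proof -
  have "\<not> negligible S"
    using assms(2) open_not_negligible[of "interior S"] negligible_subset[of S "interior S"] interior_subset by auto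
  then have "measure lebesgue S \<noteq> 0"
    using negligible_iff_measure0[OF lmeasurable_compact[OF assms(1)]] by simp
  then show ?thesis using measure_nonneg[of lebesgue S] by linarith
qed

text \<open>
  By polarization the map preserves inner products, whence the defects of additivity and
  homogeneity have norm zero.
\<close>

lemma dist_preserving_imp_linear:
  fixes f :: "'a::euclidean_space \<Rightarrow> 'b::euclidean_space"
  assumes d: "\<And>u v. dist (f u) (f v) = dist u v"
  shows "linear (\<lambda>u. f u - f 0)"
proof -
  define g where "g = (\<lambda>u. f u - f 0)"
  have nd: "norm (g u - g v) = norm (u - v)" for u v
    using d[of u v] by (simp add: g_def dist_norm)
  have ng: "norm (g u) = norm u" for u
    using nd[of u 0] by (simp add: g_def)
  have ip: "inner (g u) (g v) = inner u v" for u v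
    using arg_cong[OF nd[of u v], of "\<lambda>x. x\<^sup>2"] arg_cong[OF ng[of u], of "\<lambda>x. x\<^sup>2"] arg_cong[OF ng[of v], of "\<lambda>x. x\<^sup>2"]
    by (simp add: power2_norm_eq_inner inner_diff_left inner_diff_right inner_commute)
  have "linear g"
  proof (rule linearI)
    fix u v
    have "inner (g (u + v) - g u - g v) (g (u + v) - g u - g v) = 0"
      by (simp add: ip inner_diff_left inner_diff_right inner_add_left inner_add_right inner_commute)
    then have "g (u + v) - g u - g v = 0" by (simp only: inner_eq_zero_iff)
    then show "g (u + v) = g u + g v" by (simp add: algebra_simps)
  next
    fix r u
    have "inner (g (r *\<^sub>R u) - r *\<^sub>R g u) (g (r *\<^sub>R u) - r *\<^sub>R g u) = 0"
      by (simp add: ip inner_diff_left inner_diff_right inner_commute)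
    then have "g (r *\<^sub>R u) - r *\<^sub>R g u = 0" by (simp only: inner_eq_zero_iff)
    then show "g (r *\<^sub>R u) = r *\<^sub>R g u" by simp
  qed
  then show ?thesis by (simp add: g_def)
qed

lemma plane_isometry_exists:
  fixes w :: "real^3"
  assumes w: "w \<noteq> 0" and S: "\<And>x y. x \<in> S \<Longrightarrow> y \<in> S \<Longrightarrow> inner (x - y) w = 0"
  shows "\<exists>f :: real^2 \<Rightarrow> real^3. (\<forall>u v. dist (f u) (f v) = dist u v) \<and> S \<subseteq> range f"
proof -
  let ?H = "{x. inner w x = 0}"
  have "dim (UNIV :: (real^2) set) = dim ?H"
    using dim_hyperplane[OF w] by simp
  then obtain g :: "real^2 \<Rightarrow> real^3" where g: "linear g" "range g = ?H" "\<And>x. norm (g x) = norm x"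
    using isometry_subspaces[of "UNIV :: (real^2) set" ?H] by (auto simp: subspace_hyperplane)
  define p where "p = (SOME p. p \<in> S)"
  have "S \<subseteq> range (\<lambda>u. p + g u)"
  proof
    fix x assume x: "x \<in> S"
    then have "p \<in> S" unfolding p_def by (rule someI)
    then have "x - p \<in> range g" using S[OF x] g(2) by (simp add: inner_commute)
    then obtain u where "x - p = g u" by blast
    then have "x = p + g u" by (simp add: algebra_simps)
    then show "x \<in> range (\<lambda>u. p + g u)" by blast
  qed
  moreover have "dist (p + g u) (p + g v) = dist u v" for u v
    using g(3)[of "u - v"] g(1) by (simp add: dist_norm linear_diff)
  ultimately show ?thesis by (intro exI[of _ "\<lambda>u. p + g u"]) auto
qed

text \<open>
  Any isometric parametrization of the plane is affine, so it pulls \<open>Q\<close> back to a convex set that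
  contains a point \<open>q\<close> and its translates by two independent vectors. That set has interior points,
  also close to \<open>q\<close>, that is, in the preimage of \<open>U\<close>, where \<open>Q\<close> does not leave \<open>S\<close>.
\<close>

lemma planar_area_pos:
  fixes S Q U :: "(real^3) set"
  assumes w: "w \<noteq> 0" and plane: "\<And>x y. x \<in> S \<Longrightarrow> y \<in> S \<Longrightarrow> inner (x - y) w = 0"
    and comp: "compact S" and Q: "convex Q" "S \<subseteq> Q" and U: "open U" "Q \<inter> U \<subseteq> S"
    and p: "p \<in> S" "p \<in> U" and N: "independent N" "card N = 2" and pn: "\<And>n. n \<in> N \<Longrightarrow> p + n \<in> S"
  shows "0 < planar_area S"
proof -
  define f where "f = (SOME f :: real^2 \<Rightarrow> real^3. (\<forall>u v. dist (f u) (f v) = dist u v) \<and> S \<subseteq> range f)"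
  have "(\<forall>u v. dist (f u) (f v) = dist u v) \<and> S \<subseteq> range f"
    using someI_ex[OF plane_isometry_exists[OF w plane]] unfolding f_def .
  then have d: "\<And>u v. dist (f u) (f v) = dist u v" and Sf: "S \<subseteq> range f" by auto
  define g where "g = (\<lambda>u. f u - f 0)"
  have lin: "linear g" using dist_preserving_imp_linear[OF d] by (simp add: g_def)
  have f: "f u = f 0 + g u" for u by (simp add: g_def)
  have inj: "inj g"
  proof (rule injI)
    fix u v assume "g u = g v"
    then have "dist (f u) (f v) = 0" using f[of u] f[of v] by simp
    then show "u = v" by (simp add: d)
  qed
  have cont: "continuous_on UNIV f"
    unfolding continuous_on_iff using d by auto
  obtain q where q: "f q = p" using p Sf by auto
  have "N \<subseteq> range g"
  proof
    fix n assume "n \<in> N"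
    then obtain u where "f u = p + n" using pn Sf by (metis imageE subsetD)
    then have "g (u - q) = n" using f[of u] f[of q] q linear_diff[OF lin, of u q] by simp
    then show "n \<in> range g" by auto
  qed
  then obtain L where L: "N = g ` L" by (meson subset_imageE)
  have cardL: "card L = 2" using N(2) inj unfolding L by (simp add: card_image inj_on_subset)
  have indL: "independent L"
  proof
    assume "dependent L"
    then obtain x where x: "x \<in> L" "x \<in> span (L - {x})" by (auto simp: dependent_def)
    then have "g x \<in> span (g ` (L - {x}))" using lin by (simp add: linear_span_image)
    also have "g ` (L - {x}) = N - {g x}" using L inj x by (auto simp: inj_eq)
    finally show False using N(1) L x by (auto simp: dependent_def)
  qed
  have conv: "convex (f -` Q)"
  proof -
    have "f -` Q = g -` ((\<lambda>x. x - f 0) ` Q)"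
      by (auto simp: g_def image_iff)
    then show ?thesis using Q(1) lin by (simp add: convex_linear_vimage convex_translation_subtract)
  qed
  have "interior (f -` Q) \<noteq> {}"
  proof (rule interior_convex_of_independent[OF conv _ indL])
    show "q \<in> f -` Q" using q p Q by auto
    show "card L = DIM(real^2)" using cardL by simp
    fix n assume "n \<in> L"
    then have "p + g n \<in> S" using pn L by auto
    moreover have "f (q + n) = p + g n"
      using f[of "q + n"] f[of q] q linear_add[OF lin, of q n] by simp
    ultimately show "q + n \<in> f -` Q" using Q by auto
  qed
  then have "interior (f -` Q \<inter> f -` U) \<noteq> {}"
    using U cont p Q q by (intro interior_convex_Int_open[OF conv]) (auto intro: open_vimage)
  then have "interior (f -` S) \<noteq> {}"
    using interior_mono[of "f -` Q \<inter> f -` U" "f -` S"] U by auto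
  moreover have "compact (f -` S)"
  proof -
    have "closed (f -` S)" using comp cont by (intro closed_vimage) (auto intro: compact_imp_closed)
    moreover have "bounded (f -` S)"
    proof -
      obtain e where "\<And>x. x \<in> S \<Longrightarrow> dist p x \<le> e"
        using compact_imp_bounded[OF comp] by (metis bounded_any_center)
      then have "\<forall>u\<in>f -` S. dist q u \<le> e" using d q by (metis vimageE)
      then show ?thesis unfolding bounded_def by blast
    qed
    ultimately show ?thesis by (simp add: compact_eq_bounded_closed)
  qed
  ultimately have "0 < measure lebesgue (f -` S)" by (rule measure_pos_of_interior[rotated])
  then show ?thesis by (simp add: planar_area_def f_def[symmetric] Let_def)
qed

text \<open>
  The integrand need not be continuous. Once its values at the end points are changed to \<open>1\<close>, it is
  positive and hence Lebesgue integrable, and a zero integral would make it vanish almost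
  everywhere.
\<close>

lemma integral_pos:
  fixes f :: "real \<Rightarrow> real"
  assumes f: "f integrable_on {a..b}" and ab: "a < b"
    and pos: "\<And>x. a < x \<Longrightarrow> x < b \<Longrightarrow> 0 < f x"
  shows "0 < integral {a..b} f"
proof -
  define g where "g x = (if x \<in> {a<..<b} then f x else 1)" for x
  have sp: "integral {a..b} g = integral {a..b} f"
    by (rule integral_spike[of "{a, b}"]) (auto simp: g_def)
  have g: "g integrable_on {a..b}"
    by (rule integrable_spike[OF f, of "{a, b}"]) (auto simp: g_def)
  have gpos: "0 < g x" for x using pos by (simp add: g_def)
  have "g absolutely_integrable_on {a..b}"
    using g gpos by (intro nonnegative_absolutely_integrable_1) (auto intro: less_imp_le)
  then have int: "integrable (lebesgue_on {a..b}) g" and eq: "integral\<^sup>L (lebesgue_on {a..b}) g = integral {a..b} g"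
    by (auto simp: absolutely_integrable_imp_integrable lebesgue_integral_eq_integral)
  have "integral {a..b} g \<noteq> 0"
  proof
    assume "integral {a..b} g = 0"
    then have "AE x in lebesgue_on {a..b}. g x = 0"
      using integral_nonneg_eq_0_iff_AE[OF int] gpos eq by (simp add: less_imp_le)
    then have "AE x in lebesgue_on {a..b}. False"
      using gpos by (auto elim!: eventually_mono simp: less_le)
    then have "emeasure (lebesgue_on {a..b}) {a..b} = 0"
      by (subst (asm) AE_iff_measurable[of "{a..b}"]) (auto simp: space_restrict_space)
    then show False using ab by (simp add: emeasure_restrict_space)
  qed
  moreover have "0 \<le> integral {a..b} g" using g gpos by (intro integral_nonneg) (auto intro: less_imp_le)
  ultimately show ?thesis using sp by linarith
qed

section \<open>Simplices around interior nodes\<close>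

locale domain_mesh =
  fixes \<Omega> :: "(real^3) set" and M :: mesh
  assumes open_domain: "open \<Omega>" and mesh: "simplicial_mesh \<Omega> M"
begin

lemma finite_complex: "finite (complex M)"
  and simplex_in_complex: "S \<in> complex M \<Longrightarrow> \<exists>n. n simplex S"
  and face_in_complex: "S \<in> complex M \<Longrightarrow> F face_of S \<Longrightarrow> F \<in> complex M"
  and Int_face: "S \<in> complex M \<Longrightarrow> S' \<in> complex M \<Longrightarrow> S \<inter> S' face_of S"
proof -
  have sc: "simplicial_complex (complex M)"
    using mesh unfolding simplicial_mesh_def by blast
  then show "finite (complex M)"
    and "S \<in> complex M \<Longrightarrow> \<exists>n. n simplex S"
    and "S \<in> complex M \<Longrightarrow> S' \<in> complex M \<Longrightarrow> S \<inter> S' face_of S"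
    by (simp_all add: simplicial_complex_def)
  show "F \<in> complex M" if "S \<in> complex M" "F face_of S"
    using sc that unfolding simplicial_complex_def by fast
qed

lemma simplex_subset_if_meets_rel_interior:
  assumes S: "S \<in> complex M" "S' \<in> complex M" and p: "p \<in> rel_interior S" "p \<in> S'"
  shows "S \<subseteq> S'"
proof -
  have "(S \<inter> S') \<inter> rel_interior S \<noteq> {}" using p rel_interior_subset[of S] by blast
  from subset_of_face_of[OF Int_face[OF S] subset_refl this] show ?thesis by blast
qed

lemma Union_complex: "\<Union>(complex M) = closure \<Omega>"
  using mesh unfolding simplicial_mesh_def by blast

lemma node_iff: "p \<in> set (nodes M) \<longleftrightarrow> {p} \<in> complex M"
  using mesh unfolding simplicial_mesh_def by blast

lemma singleton_node_in_complex: "i < num_nodes M \<Longrightarrow> {node M i} \<in> complex M"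
  using node_iff[of "node M i"] by simp

lemma edge_iff: "(i, j) \<in> set (edges M) \<longleftrightarrow>
    i < j \<and> j < num_nodes M \<and> closed_segment (node M i) (node M j) \<in> complex M"
  using mesh unfolding simplicial_mesh_def by blast

lemma node_inj: "i < num_nodes M \<Longrightarrow> j < num_nodes M \<Longrightarrow> node M i = node M j \<longleftrightarrow> i = j"
  using mesh unfolding simplicial_mesh_def by (simp add: nth_eq_iff_index_eq)

lemma frontier_eq: "frontier \<Omega> = closure \<Omega> - \<Omega>"
  using open_domain by (simp add: frontier_def interior_open)

lemma node_in_closure: "i < num_nodes M \<Longrightarrow> node M i \<in> closure \<Omega>"
  using node_iff[of "node M i"] Union_complex by auto

lemma interior_nodes_iff: "i \<in> set (interior_nodes \<Omega> M) \<longleftrightarrow> i < num_nodes M \<and> node M i \<in> \<Omega>"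
  using node_in_closure by (auto simp: interior_nodes_def frontier_eq)

lemma elements_subset: "T \<in> elements M \<Longrightarrow> T \<in> complex M"
  by (simp add: elements_def)

lemma element_subset_closure: "T \<in> elements M \<Longrightarrow> T \<subseteq> closure \<Omega>"
  using elements_subset Union_complex by blast

lemma element_simplex:
  assumes "T \<in> elements M"
  obtains C where "\<not> affine_dependent C" "card C = 4" "T = convex hull C"
  using assms unfolding elements_def simplex_def by fastforce

lemma element_rel_interior:
  assumes "T \<in> elements M"
  shows "rel_interior T = interior T"
proof -
  have "aff_dim T = DIM(real^3)"
    using assms aff_dim_simplex unfolding elements_def by fastforce
  then show ?thesis using aff_dim_eq_full rel_interior_interior by blast
qed

lemma interior_non_element:
  assumes "S \<in> complex M" "S \<notin> elements M"
  shows "interior S = {}"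
proof (rule ccontr)
  assume "interior S \<noteq> {}"
  then have "aff_dim S = 3" using aff_dim_nonempty_interior by fastforce
  moreover obtain n where "n simplex S" using simplex_in_complex[OF assms(1)] by blast
  ultimately show False using assms aff_dim_simplex unfolding elements_def by fastforce
qed

text \<open>
  This is where it matters that the mesh resolves the boundary: a frontier point in the relative
  interior of \<open>S\<close> lies in a simplex \<open>F \<subseteq> frontier \<Omega>\<close>, which then contains all of \<open>S\<close>, including \<open>x\<close>.
\<close>

lemma rel_interior_subset_domain:
  assumes S: "S \<in> complex M" and x: "x \<in> S" "x \<in> \<Omega>"
  shows "rel_interior S \<subseteq> \<Omega>"
proof
  fix p assume p: "p \<in> rel_interior S"
  obtain \<B> where \<B>: "\<B> \<subseteq> complex M" "frontier \<Omega> = \<Union>\<B>"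
    using mesh unfolding simplicial_mesh_def by blast
  show "p \<in> \<Omega>"
  proof (rule ccontr)
    assume "p \<notin> \<Omega>"
    then have "p \<in> frontier \<Omega>"
      using p S Union_complex rel_interior_subset[of S] unfolding frontier_eq by blast
    then obtain F where F: "F \<in> \<B>" "p \<in> F" using \<B> by blast
    then have "S \<subseteq> F"
      using simplex_subset_if_meets_rel_interior[OF S _ p] \<B>(1) by blast
    then have "x \<in> frontier \<Omega>" using x(1) F(1) \<B>(2) by blast
    with x(2) show False unfolding frontier_eq by blast
  qed
qed

text \<open>
  Otherwise \<open>p\<close> has a neighbourhood outside the closed union of the elements meeting \<open>U\<close>, and the
  part of it in \<open>U\<close>, a nonempty open set, would be covered by simplices of lower dimension.
\<close>

lemma element_at_limit:
  assumes U: "open U" "U \<subseteq> closure \<Omega>" and p: "p \<in> closure U"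
  shows "\<exists>T\<in>elements M. p \<in> T \<and> T \<inter> U \<noteq> {}"
proof (rule ccontr)
  assume none: "\<not> ?thesis"
  define K where "K = \<Union>{T \<in> elements M. T \<inter> U \<noteq> {}}"
  have "closed K" unfolding K_def
    using finite_complex closed_simplex
    by (intro closed_Union) (auto simp: elements_def)
  then have W: "open (U - K)" using U(1) by blast
  have "p \<in> - K" using none by (auto simp: K_def)
  then have "U - K \<noteq> {}"
    using p \<open>closed K\<close> open_Int_closure_eq_empty[of "- K" U] by auto
  then have "\<not> negligible (U - K)" using W open_not_negligible by blast
  moreover have "U - K \<subseteq> \<Union>(complex M - elements M)"
  proof
    fix y assume y: "y \<in> U - K"
    then obtain S where S: "S \<in> complex M" "y \<in> S" using U(2) Union_complex by blast
    with y have "S \<notin> elements M" by (auto simp: K_def)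
    with S show "y \<in> \<Union>(complex M - elements M)" by blast
  qed
  moreover have "negligible (\<Union>(complex M - elements M))"
  proof (rule negligible_Union)
    show "finite (complex M - elements M)" using finite_complex by simp
    fix S assume S: "S \<in> complex M - elements M"
    then obtain n where "n simplex S" using simplex_in_complex[of S] by blast
    then have "convex S" by (rule convex_simplex)
    moreover have "interior S = {}" using S interior_non_element[of S] by blast
    ultimately show "negligible S" using negligible_convex_interior[of S] by blast
  qed
  ultimately show False using negligible_subset by blast
qed

lemma element_containing_simplex:
  assumes S: "S \<in> complex M" and x: "x \<in> S" "x \<in> \<Omega>"
  shows "\<exists>T\<in>elements M. S \<subseteq> T"
proof -
  have "convex S" using simplex_in_complex[OF S] convex_simplex[of _ S] by blast
  then obtain p where p: "p \<in> rel_interior S" using x(1) rel_interior_eq_empty[of S] by blast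
  then have "p \<in> closure \<Omega>" using rel_interior_subset_domain[OF S x] closure_subset[of \<Omega>] by blast
  then obtain T where T: "T \<in> elements M" "p \<in> T"
    using element_at_limit[OF open_domain closure_subset] by blast
  then have "S \<subseteq> T"
    using simplex_subset_if_meets_rel_interior[OF S elements_subset p] by blast
  with T(1) show ?thesis by blast
qed

lemma element_eq_if_interiors_meet:
  assumes T: "T \<in> elements M" "T' \<in> elements M" and p: "p \<in> interior T" "p \<in> interior T'"
  shows "T = T'"
proof -
  have "p \<in> rel_interior T" "p \<in> rel_interior T'" "p \<in> T" "p \<in> T'"
    using p element_rel_interior[OF T(1)] element_rel_interior[OF T(2)]
      interior_subset[of T] interior_subset[of T'] by auto
  then show ?thesis
    using simplex_subset_if_meets_rel_interior[OF T[THEN elements_subset]]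
      simplex_subset_if_meets_rel_interior[OF T(2,1)[THEN elements_subset]] by blast
qed

text \<open>
  A point in the relative interior of \<open>F\<close> lies in \<open>\<Omega>\<close> and on the boundary of \<open>T\<close>, so it is a limit
  of points of \<open>\<Omega> - T\<close>. An element that contains it and meets \<open>\<Omega> - T\<close> contains all of \<open>F\<close>.
\<close>

lemma element_neighbour:
  assumes T: "T \<in> elements M" and F: "F face_of T" "F \<noteq> T" and x: "x \<in> F" "x \<in> \<Omega>"
  shows "\<exists>T'\<in>elements M. T' \<noteq> T \<and> F \<subseteq> T'"
proof -
  note TC = elements_subset[OF T]
  have closedT: "closed T" using simplex_in_complex[OF TC] closed_simplex[of _ T] by blast
  have FC: "F \<in> complex M" by (rule face_in_complex[OF TC F(1)])
  then have "convex F" using simplex_in_complex[of F] convex_simplex[of _ F] by blast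
  then obtain p where p: "p \<in> rel_interior F" using x(1) rel_interior_eq_empty[of F] by blast
  have p\<Omega>: "p \<in> \<Omega>" using rel_interior_subset_domain[OF FC x] p by blast
  have pF: "p \<in> F" using p rel_interior_subset by blast
  have "p \<notin> interior T"
    using face_of_disjoint_rel_interior[OF F] pF element_rel_interior[OF T] by blast
  have "p \<in> closure (\<Omega> - T)"
  proof (rule ccontr)
    assume "p \<notin> closure (\<Omega> - T)"
    then have "p \<in> \<Omega> - closure (\<Omega> - T)" using p\<Omega> by blast
    moreover have "open (\<Omega> - closure (\<Omega> - T))" using open_domain by (simp add: open_Diff)
    moreover have "\<Omega> - closure (\<Omega> - T) \<subseteq> T" using closure_subset[of "\<Omega> - T"] by blast
    ultimately have "p \<in> interior T" by (meson interiorI)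
    with \<open>p \<notin> interior T\<close> show False ..
  qed
  moreover have "open (\<Omega> - T)" using open_domain closedT by (rule open_Diff)
  moreover have "\<Omega> - T \<subseteq> closure \<Omega>" using closure_subset[of \<Omega>] by blast
  ultimately obtain T' where T': "T' \<in> elements M" "p \<in> T'" "T' \<inter> (\<Omega> - T) \<noteq> {}"
    using element_at_limit[of "\<Omega> - T" p] by blast
  have "F \<subseteq> T'"
    by (rule simplex_subset_if_meets_rel_interior[OF FC elements_subset[OF T'(1)] p T'(2)])
  with T' show ?thesis by blast
qed

lemma element_node_vertex:
  assumes T: "T \<in> elements M" "T = convex hull C" and i: "i < num_nodes M" "node M i \<in> T"
  shows "node M i \<in> C"
proof -
  have "{node M i} \<in> complex M" by (rule singleton_node_in_complex[OF i(1)])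
  then have "T \<inter> {node M i} face_of T" by (rule Int_face[OF elements_subset[OF T(1)]])
  moreover have "T \<inter> {node M i} = {node M i}" using i(2) by blast
  ultimately have "node M i extreme_point_of (convex hull C)"
    using T(2) by (simp add: face_of_singleton)
  then show ?thesis by (rule extreme_point_of_convex_hull)
qed

lemma element_vertex_node:
  assumes T: "T \<in> elements M" and C: "\<not> affine_dependent C" "T = convex hull C" and x: "x \<in> C"
  obtains i where "i < num_nodes M" "node M i = x"
proof -
  have "{x} face_of T"
    using x C by (simp add: face_of_singleton extreme_point_of_convex_hull_affine_independent)
  then have "x \<in> set (nodes M)"
    unfolding node_iff by (rule face_in_complex[OF elements_subset[OF T]])
  then show ?thesis unfolding in_set_conv_nth using that by blast
qed

lemma element_edge:
  assumes T: "T \<in> elements M" and ij: "i < num_nodes M" "j < num_nodes M" "i \<noteq> j"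
    and in_T: "node M i \<in> T" "node M j \<in> T"
  shows "(i, j) \<in> set (edges M) \<or> (j, i) \<in> set (edges M)"
proof -
  obtain C where C: "\<not> affine_dependent C" "card C = 4" "T = convex hull C" using element_simplex[OF T] .
  have "{node M i, node M j} \<subseteq> C" using element_node_vertex[OF T C(3) ij(1) in_T(1)] element_node_vertex[OF T C(3) ij(2) in_T(2)] by simp
  then have "closed_segment (node M i) (node M j) face_of T"
    unfolding segment_convex_hull C(3) using face_of_convex_hull_affine_independent[OF C(1)] by blast
  then have "closed_segment (node M i) (node M j) \<in> complex M"
    by (rule face_in_complex[OF elements_subset[OF T]])
  then have "closed_segment (node M j) (node M i) \<in> complex M"
    "closed_segment (node M i) (node M j) \<in> complex M" by (simp_all add: closed_segment_commute)
  then show ?thesis using ij edge_iff[of i j] edge_iff[of j i] by (cases "i < j") auto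
qed

text \<open>
  The node is a limit of points of \<open>\<Omega>\<close> above it, so some element at the node has a point above it,
  and then also a vertex, since the points that are not above form a convex set.
\<close>

lemma interior_node_higher_neighbour:
  assumes i: "i < num_nodes M" "node M i \<in> \<Omega>" and e: "e \<noteq> 0"
  shows "\<exists>j<num_nodes M. ((i, j) \<in> set (edges M) \<or> (j, i) \<in> set (edges M)) \<and>
           inner e (node M i) < inner e (node M j)"
proof -
  let ?x = "node M i"
  let ?U = "\<Omega> \<inter> {y. inner e y > inner e ?x}"
  have "?x \<in> closure {y. inner e y > inner e ?x}"
    using closure_halfspace_gt[OF e, of "inner e ?x"] by simp
  then have "?x \<in> closure ?U"
    using open_Int_closure_subset[OF open_domain, of "{y. inner e y > inner e ?x}"] i(2) by blast
  moreover have "open ?U" using open_domain open_halfspace_gt by (rule open_Int)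
  moreover have "?U \<subseteq> closure \<Omega>" using closure_subset[of \<Omega>] by blast
  ultimately obtain T where T': "T \<in> elements M" "?x \<in> T" "T \<inter> ?U \<noteq> {}"
    using element_at_limit[of ?U ?x] by blast
  then obtain y where T: "T \<in> elements M" "?x \<in> T" "y \<in> T" "inner e ?x < inner e y" by blast
  obtain C where C: "\<not> affine_dependent C" "card C = 4" "T = convex hull C"
    using element_simplex[OF T(1)] .
  have "\<exists>v\<in>C. inner e ?x < inner e v"
  proof (rule ccontr)
    assume "\<not> ?thesis"
    then have "C \<subseteq> {v. inner e v \<le> inner e ?x}" by auto
    then have "T \<subseteq> {v. inner e v \<le> inner e ?x}"
      unfolding C(3) by (intro hull_minimal) (auto simp: convex_halfspace_le)
    with T(3,4) show False by auto
  qed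
  then obtain v where v: "v \<in> C" "inner e ?x < inner e v" by blast
  obtain j where j: "j < num_nodes M" "node M j = v" using element_vertex_node[OF T(1) C(1,3) v(1)] .
  have "node M j \<in> T" using j v(1) C(3) by (simp add: hull_inc)
  moreover have "i \<noteq> j" using v(2) j(2) by auto
  ultimately show ?thesis using element_edge[OF T(1) i(1) j(1)] T(2) j v(2) by blast
qed

end

section \<open>Dual cells and dual faces\<close>

locale dual_domain_mesh = domain_mesh +
  fixes c :: "(real^3) set \<Rightarrow> real^3" and V :: "nat \<Rightarrow> (real^3) set"
  assumes dual: "dual_mesh \<Omega> M c V" and nondeg: "nondegenerate M c"
begin

lemma cell_polyhedral: "\<forall>i<num_nodes M. polyhedral_set (V i)"
  and interior_cell_clipped: "\<forall>i\<in>set (interior_nodes \<Omega> M). clipped_polyhedron \<Omega> (V i)"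
  and face_clipped: "\<forall>(i, j)\<in>set (edges M).
        i \<in> set (interior_nodes \<Omega> M) \<or> j \<in> set (interior_nodes \<Omega> M) \<longrightarrow>
        clipped_polyhedron \<Omega> (dual_face V (i, j))"
  and dual_node_common: "\<forall>T\<in>elements M. \<forall>i<num_nodes M. node M i \<in> T \<longrightarrow> c T \<in> V i"
  and face_orthogonal: "\<forall>(i, j)\<in>set (edges M). \<forall>p\<in>dual_face V (i, j). \<forall>q\<in>dual_face V (i, j).
        inner (p - q) (node M j - node M i) = 0"
  using dual unfolding dual_mesh_def by - (elim conjE, assumption)+

lemma cell_compact: "i < num_nodes M \<Longrightarrow> compact (V i)"
proof -
  assume "i < num_nodes M"
  then have "polyhedral_set (V i)" using cell_polyhedral by blast
  then obtain \<P> where "finite \<P>" "\<And>P. P \<in> \<P> \<Longrightarrow> polytope P" "V i = \<Union>\<P>"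
    unfolding polyhedral_set_def by blast
  moreover from this have "compact (\<Union>\<P>)"
    by (intro compact_Union) (simp_all add: polytope_imp_compact)
  ultimately show "compact (V i)" by simp
qed

lemma dual_node_in_cell: "T \<in> elements M \<Longrightarrow> i < num_nodes M \<Longrightarrow> node M i \<in> T \<Longrightarrow> c T \<in> V i"
  using dual_node_common by blast

lemma dual_node_interior: "T \<in> elements M \<Longrightarrow> c T \<in> interior T"
  using nondeg unfolding nondegenerate_def by blast

lemma dual_face_orthogonal:
  assumes "(i, j) \<in> set (edges M)" "p \<in> dual_face V (i, j)" "q \<in> dual_face V (i, j)"
  shows "inner (p - q) (node M j - node M i) = 0"
  using face_orthogonal assms by fast

lemma dual_node_difference_orthogonal:
  assumes T: "T \<in> elements M" "T' \<in> elements M"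
    and ij: "i < num_nodes M" "j < num_nodes M"
    and i: "node M i \<in> T" "node M i \<in> T'" and j: "node M j \<in> T" "node M j \<in> T'"
  shows "inner (c T' - c T) (node M j - node M i) = 0"
proof (cases "i = j")
  case False
  have in_V: "c T \<in> V i \<inter> V j" "c T' \<in> V i \<inter> V j"
    using dual_node_in_cell[OF T(1) ij(1) i(1)] dual_node_in_cell[OF T(1) ij(2) j(1)]
      dual_node_in_cell[OF T(2) ij(1) i(2)] dual_node_in_cell[OF T(2) ij(2) j(2)] by simp_all
  from element_edge[OF T(1) ij False i(1) j(1)] show ?thesis
  proof
    assume "(i, j) \<in> set (edges M)"
    then show ?thesis
      using dual_face_orthogonal[of i j "c T'" "c T"] in_V by (simp add: dual_face_def)
  next
    assume "(j, i) \<in> set (edges M)"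
    then have "inner (c T' - c T) (node M i - node M j) = 0"
      using dual_face_orthogonal[of j i "c T'" "c T"] in_V by (simp add: dual_face_def)
    then show ?thesis by (simp add: inner_diff_right)
  qed
qed simp

text \<open>
  Comparing \<open>c T\<close> with the dual nodes of the neighbours of \<open>T\<close> across the facets through \<open>a\<close>, where
  \<open>b\<close> is the vertex opposite to the facet. Orthogonality to the facet follows from its edges:
  both dual nodes belong to the faces dual to them.
\<close>

lemma dual_node_differences:
  assumes T: "T \<in> elements M" and C: "\<not> affine_dependent C" "card C = 4" "T = convex hull C"
    and a: "a \<in> C" "a \<in> \<Omega>"
  shows "\<exists>n. independent (n ` (C - {a})) \<and> inj_on n (C - {a}) \<and>
    (\<forall>b\<in>C - {a}. \<exists>T'\<in>elements M. C - {b} \<subseteq> T' \<and> c T' = c T + n b)"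
proof -
  have ex: "\<exists>T'\<in>elements M. T' \<noteq> T \<and> C - {b} \<subseteq> T'" if b: "b \<in> C - {a}" for b
  proof -
    let ?F = "convex hull (C - {b})"
    have sub: "C - {b} \<subseteq> ?F" by (rule hull_subset)
    have face: "?F face_of T"
      unfolding C(3) using face_of_convex_hull_affine_independent[OF C(1)] by blast
    have "?F \<noteq> T"
    proof
      assume "?F = T"
      moreover have "b \<in> T" using b C(3) by (simp add: hull_inc)
      ultimately have "b \<in> convex hull (C - {b})" by simp
      then have "b \<in> affine hull (C - {b})" using convex_hull_subset_affine_hull by blast
      then show False using C(1) b by (auto simp: affine_dependent_def)
    qed
    moreover have "a \<in> ?F" using a(1) b sub by auto
    ultimately show ?thesis using element_neighbour[OF T face _ _ a(2)] sub by blast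
  qed
  define N where "N b = (SOME T'. T' \<in> elements M \<and> T' \<noteq> T \<and> C - {b} \<subseteq> T')" for b
  have N: "N b \<in> elements M" "N b \<noteq> T" "C - {b} \<subseteq> N b" if "b \<in> C - {a}" for b
  proof -
    have "\<exists>T'. T' \<in> elements M \<and> T' \<noteq> T \<and> C - {b} \<subseteq> T'" using ex[OF that] by blast
    from someI_ex[OF this] show "N b \<in> elements M" "N b \<noteq> T" "C - {b} \<subseteq> N b"
      unfolding N_def by blast+
  qed
  define n where "n b = c (N b) - c T" for b
  have n0: "n b \<noteq> 0" if b: "b \<in> C - {a}" for b
  proof
    assume "n b = 0"
    then have "c T \<in> interior (N b)" using dual_node_interior[OF N(1)[OF b]] by (simp add: n_def)
    then show False
      using element_eq_if_interiors_meet[OF N(1)[OF b] T _ dual_node_interior[OF T]] N(2)[OF b] by blast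
  qed
  have orth: "inner (n b) (x - a) = 0" if b: "b \<in> C - {a}" and x: "x \<in> C - {b}" for b x
  proof -
    obtain i where i: "i < num_nodes M" "node M i = x"
      using element_vertex_node[OF T C(1,3), of x] x by blast
    obtain k where k: "k < num_nodes M" "node M k = a"
      using element_vertex_node[OF T C(1,3) a(1)] .
    have "x \<in> T" "a \<in> T" using x a C(3) by (auto simp: hull_inc)
    moreover have "x \<in> N b" "a \<in> N b" using N(3)[OF b] x a(1) b by auto
    ultimately show ?thesis
      using dual_node_difference_orthogonal[OF T N(1)[OF b] k(1) i(1)] i k by (simp add: n_def)
  qed
  have card: "card C = DIM(real^3) + 1" using C(2) by simp
  show ?thesis
  proof (intro exI conjI ballI)
    show "independent (n ` (C - {a}))" "inj_on n (C - {a})"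
      by (rule biorthogonal_family_independent[OF C(1) card a(1) n0 orth]; assumption)+
    show "\<exists>T'\<in>elements M. C - {b} \<subseteq> T' \<and> c T' = c T + n b" if "b \<in> C - {a}" for b
      using N[OF that] by (intro bexI[of _ "N b"]) (auto simp: n_def)
  qed
qed

text \<open>
  The cell contains \<open>c T\<close> and the dual nodes of the three neighbours of an element \<open>T\<close> at the node,
  which do not lie in a plane.
\<close>

lemma cell_volume_pos:
  assumes i: "i \<in> set (interior_nodes \<Omega> M)"
  shows "0 < measure lebesgue (V i)"
proof -
  let ?a = "node M i"
  have i': "i < num_nodes M" "?a \<in> \<Omega>" using i interior_nodes_iff[of i] by auto
  have "clipped_polyhedron \<Omega> (V i)" using interior_cell_clipped i by blast
  then obtain Q where Q: "polyhedron Q" "V i = Q \<inter> closure \<Omega>" unfolding clipped_polyhedron_def by blast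
  have conv: "convex Q" using Q(1) by (rule polyhedron_imp_convex)
  have "{?a} \<in> complex M" by (rule singleton_node_in_complex[OF i'(1)])
  then obtain T where T: "T \<in> elements M" "?a \<in> T"
    using element_containing_simplex[of "{?a}" ?a] i'(2) by auto
  obtain C where C: "\<not> affine_dependent C" "card C = 4" "T = convex hull C" using element_simplex[OF T(1)] .
  have a: "?a \<in> C" using element_node_vertex[OF T(1) C(3) i'(1) T(2)] .
  obtain n where n: "independent (n ` (C - {?a}))" "inj_on n (C - {?a})"
    "\<forall>b\<in>C - {?a}. \<exists>T'\<in>elements M. C - {b} \<subseteq> T' \<and> c T' = c T + n b"
    using dual_node_differences[OF T(1) C a i'(2)] by (elim exE conjE)
  have cQ: "c T \<in> Q" using dual_node_in_cell[OF T(1) i'(1) T(2)] Q(2) by blast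
  have "interior Q \<noteq> {}"
  proof (rule interior_convex_of_independent[OF conv cQ n(1)])
    show "card (n ` (C - {?a})) = DIM(real^3)" using n(2) C(2) a by (simp add: card_image)
    fix m assume "m \<in> n ` (C - {?a})"
    then obtain b T' where b: "b \<in> C - {?a}" "T' \<in> elements M" "C - {b} \<subseteq> T'" "c T' = c T + m"
      using n(3) by blast
    then have "?a \<in> T'" using a by auto
    then have "c T' \<in> V i" using dual_node_in_cell[OF b(2) i'(1)] by blast
    then show "c T + m \<in> Q" using b(4) Q(2) by simp
  qed
  then have "interior (Q \<inter> interior T) \<noteq> {}"
    using interior_convex_Int_open[OF conv _ open_interior cQ] dual_node_interior[OF T(1)] by blast
  moreover have "Q \<inter> interior T \<subseteq> V i"
    using element_subset_closure[OF T(1)] interior_subset[of T] Q(2) by blast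
  ultimately have "interior (V i) \<noteq> {}" using interior_mono by blast
  then show ?thesis using measure_pos_of_interior[OF cell_compact[OF i'(1)]] by blast
qed

text \<open>
  Of the three neighbours of \<open>T\<close> at an interior end point \<open>a\<close> of the edge \<open>a b\<close>, the two across the
  facets that contain \<open>b\<close> have their dual nodes in the face dual to the edge.
\<close>

lemma dual_face_area_pos:
  assumes e: "(i, j) \<in> set (edges M)"
    and int: "i \<in> set (interior_nodes \<Omega> M) \<or> j \<in> set (interior_nodes \<Omega> M)"
  shows "0 < planar_area (dual_face V (i, j))"
proof -
  let ?E = "closed_segment (node M i) (node M j)"
  let ?S = "dual_face V (i, j)"
  have ij: "i < num_nodes M" "j < num_nodes M" "i \<noteq> j" "?E \<in> complex M" using e edge_iff[of i j] by auto
  have ne: "node M i \<noteq> node M j" using node_inj[of i j] ij by simp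
  (* Either end point may be the interior one; a denotes an interior end point. *)
  obtain a b where ab: "a = node M i \<and> b = node M j \<or> a = node M j \<and> b = node M i" "a \<in> \<Omega>" "a \<noteq> b"
  proof (cases "node M i \<in> \<Omega>")
    case True
    then show ?thesis using that[of "node M i" "node M j"] ne by simp
  next
    case False
    then have "node M j \<in> \<Omega>" using int interior_nodes_iff[of i] interior_nodes_iff[of j] by blast
    then show ?thesis
      using that[of "node M j" "node M i"] ne by simp
  qed
  have "a \<in> ?E" using ab(1) by auto
  then obtain T where T: "T \<in> elements M" "?E \<subseteq> T"
    using element_containing_simplex[OF ij(4) _ ab(2)] by blast
  then have in_T: "node M i \<in> T" "node M j \<in> T" by auto
  obtain C where C: "\<not> affine_dependent C" "card C = 4" "T = convex hull C" using element_simplex[OF T(1)] .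
  have ijC: "node M i \<in> C" "node M j \<in> C"
    using element_node_vertex[OF T(1) C(3) ij(1) in_T(1)] element_node_vertex[OF T(1) C(3) ij(2) in_T(2)] .
  then have abC: "a \<in> C" "b \<in> C" using ab(1) ijC by blast+
  obtain n where n: "independent (n ` (C - {a}))" "inj_on n (C - {a})"
    "\<forall>b\<in>C - {a}. \<exists>T'\<in>elements M. C - {b} \<subseteq> T' \<and> c T' = c T + n b"
    using dual_node_differences[OF T(1) C abC(1) ab(2)] by (elim exE conjE)
  have "clipped_polyhedron \<Omega> ?S" using face_clipped e int by fast
  then obtain Q where Q: "polyhedron Q" "?S = Q \<inter> closure \<Omega>" unfolding clipped_polyhedron_def by blast
  have sub: "C - {a, b} \<subseteq> C - {a}" by blast
  have cS: "c T \<in> ?S" using dual_node_in_cell[OF T(1)] ij in_T by (simp add: dual_face_def)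
  show ?thesis
  proof (rule planar_area_pos)
    show "node M j - node M i \<noteq> 0" using ne by simp
    show "inner (x - y) (node M j - node M i) = 0" if "x \<in> ?S" "y \<in> ?S" for x y
      using dual_face_orthogonal[OF e that] .
    show "compact ?S" using cell_compact ij by (simp add: dual_face_def compact_Int)
    show "convex Q" using Q(1) by (rule polyhedron_imp_convex)
    show "?S \<subseteq> Q" using Q(2) by blast
    show "open (interior T)" by simp
    show "Q \<inter> interior T \<subseteq> ?S"
      using element_subset_closure[OF T(1)] interior_subset[of T] Q(2) by blast
    show "c T \<in> ?S" by (rule cS)
    show "c T \<in> interior T" by (rule dual_node_interior[OF T(1)])
    show "independent (n ` (C - {a, b}))" using n(1) sub by (meson image_mono independent_mono)
    show "card (n ` (C - {a, b})) = 2"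
    proof -
      have "card (C - {a, b}) = 2" using C(2) abC ab(3) by (simp add: card_Diff_subset)
      then show ?thesis using card_image[OF inj_on_subset[OF n(2) sub]] by simp
    qed
    fix m assume "m \<in> n ` (C - {a, b})"
    then obtain x T' where x: "x \<in> C - {a, b}" "T' \<in> elements M" "C - {x} \<subseteq> T'" "c T' = c T + m"
      using n(3) by blast
    have "node M i \<in> C - {x}" "node M j \<in> C - {x}" using x(1) ijC ab(1) by blast+
    then have "c T' \<in> V i" "c T' \<in> V j"
      using dual_node_in_cell[OF x(2)] ij(1,2) x(3) by blast+
    then show "c T + m \<in> ?S" using x(4) by (simp add: dual_face_def)
  qed
qed

end

section \<open>Entries of the stiffness matrix\<close>

lemma minv_mat_diag:
  fixes d :: "nat \<Rightarrow> real"
  assumes d: "\<And>k. k < n \<Longrightarrow> d k \<noteq> 0"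
  shows "minv (mat_diag n d) = mat_diag n (\<lambda>k. 1 / d k)"
proof -
  let ?A = "mat_diag n d" and ?B = "mat_diag n (\<lambda>k. 1 / d k)"
  have A: "?A \<in> carrier_mat n n" and B: "?B \<in> carrier_mat n n" by simp_all
  have AB: "?A * ?B = 1\<^sub>m n"
    unfolding mat_diag_diag by (rule eq_matI) (auto simp: mat_diag_def d)
  then have "det ?A * det ?B = 1" using det_mult[OF A B] by simp
  then have "det ?A \<noteq> 0" by auto
  note inv = minv_inverse[OF A this]
  have "minv ?A = minv ?A * (?A * ?B)" using inv(3) AB by simp
  also have "\<dots> = minv ?A * ?A * ?B" using assoc_mult_mat[OF inv(3) A B] by simp
  finally show ?thesis using inv(2) B by simp
qed

lemma weighted_Laplacian_entry:
  fixes G :: "real mat"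
  assumes G: "G \<in> carrier_mat m n" and r: "r < n" and s: "s < n"
  shows "(mat_diag n d * transpose_mat G * mat_diag m w * G * mat_diag n u + mat_diag n g) $$ (r, s) =
    d r * (\<Sum>k<m. G $$ (k, r) * w k * G $$ (k, s)) * u s + (if r = s then g r else 0)"
proof -
  have GT: "transpose_mat G \<in> carrier_mat n m" using G by simp
  let ?P = "mat_diag n d * transpose_mat G * mat_diag m w"
  have P: "?P = Matrix.mat n m (\<lambda>(i, k). d i * G $$ (k, i) * w k)"
    using G by (subst mat_diag_mult_left[OF GT], subst mat_diag_mult_right[of _ n m]) auto
  have "(?P * G) $$ (r, s) = (\<Sum>k<m. d r * G $$ (k, r) * w k * G $$ (k, s))"
    using G r s unfolding P by (simp add: scalar_prod_def atLeast0LessThan)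
  moreover have PG: "?P * G \<in> carrier_mat n n" unfolding P by (rule mult_carrier_mat[OF mat_carrier G])
  ultimately have "(?P * G * mat_diag n u) $$ (r, s) = (\<Sum>k<m. d r * G $$ (k, r) * w k * G $$ (k, s)) * u s"
    using r s by (subst mat_diag_mult_right[OF PG]) simp
  moreover have "mat_diag n g $$ (r, s) = (if r = s then g r else 0)"
    using r s by (simp add: mat_diag_def)
  moreover have "(?P * G * mat_diag n u + mat_diag n g) $$ (r, s) =
      (?P * G * mat_diag n u) $$ (r, s) + mat_diag n g $$ (r, s)"
    using r s by (intro index_add_mat(1)) (simp_all add: mat_diag_def)
  ultimately show ?thesis by (simp add: sum_distrib_left mult.assoc)
qed

lemma incidence_entry:
  assumes "k < num_edges M" "r < length (interior_nodes \<Omega> M)" "edges M ! k = (i, j)"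
  shows "incidence_mat \<Omega> M $$ (k, r) =
    (if interior_nodes \<Omega> M ! r = i then - 1 else if interior_nodes \<Omega> M ! r = j then 1 else 0)"
  using assms by (simp add: incidence_mat_def)

text \<open>
  The two signs of an edge cancel unless exactly one of its end points is an interior node, the
  columns of boundary nodes being eliminated.
\<close>

lemma incidence_row_sum:
  assumes k: "k < num_edges M" "edges M ! k = (i, j)" and ij: "i \<noteq> j"
  shows "(\<Sum>r<length (interior_nodes \<Omega> M). incidence_mat \<Omega> M $$ (k, r)) =
    of_bool (j \<in> set (interior_nodes \<Omega> M)) - of_bool (i \<in> set (interior_nodes \<Omega> M))"
proof -
  let ?I = "interior_nodes \<Omega> M"
  let ?f = "\<lambda>a. if a = i then - 1 else if a = j then 1 else (0 :: real)"
  have dist: "distinct ?I" by (simp add: interior_nodes_def)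
  have "(\<Sum>r<length ?I. incidence_mat \<Omega> M $$ (k, r)) = (\<Sum>r<length ?I. ?f (?I ! r))"
    using incidence_entry[OF k(1) _ k(2)] by (intro sum.cong) auto
  also have "\<dots> = (\<Sum>a\<in>set ?I. ?f a)"
    using sum.reindex_bij_betw[OF bij_betw_nth[OF dist refl refl], of ?f] by simp
  also have "\<dots> = (\<Sum>a\<in>set ?I. (if j = a then 1 else 0) - (if i = a then 1 else 0))"
    using ij by (intro sum.cong) auto
  finally show ?thesis by (simp add: sum_subtractf sum.delta')
qed

section \<open>Positive weights\<close>

context domain_mesh
begin

lemma edge_length_pos:
  assumes "e \<in> set (edges M)"
  shows "0 < edge_length M e"
proof -
  obtain i j where e: "e = (i, j)" by (cases e)
  then show ?thesis
    using assms edge_iff[of i j] node_inj[of i j] by (auto simp: edge_length_def)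
qed

text \<open>
  The value of \<open>f\<close> at the end points is left open, as an end point may lie on the boundary, where
  nothing is known about the coefficients.
\<close>

lemma edge_average_pos:
  assumes e: "(i, j) \<in> set (edges M)" and f: "integrable_on_edge M f (i, j)"
    and pos: "\<And>x. x \<in> open_segment (node M i) (node M j) \<Longrightarrow> 0 < f x"
  shows "0 < edge_average M f (i, j)"
proof -
  let ?L = "edge_length M (i, j)"
  note L = edge_length_pos[OF e]
  have ne: "node M i \<noteq> node M j" using L by (auto simp: edge_length_def)
  have "0 < integral {0..?L} (\<lambda>s. f (edge_point M (i, j) s))"
  proof (rule integral_pos)
    show "(\<lambda>s. f (edge_point M (i, j) s)) integrable_on {0..?L}"
      using f by (simp add: integrable_on_edge_def)
    show "0 < ?L" by (rule L)
    fix s assume s: "0 < s" "s < ?L"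
    then have "0 < s / ?L" "s / ?L < 1" using L by simp_all
    moreover have "edge_point M (i, j) s = (1 - s / ?L) *\<^sub>R node M i + (s / ?L) *\<^sub>R node M j"
      by (simp add: edge_point_def algebra_simps)
    ultimately have "edge_point M (i, j) s \<in> open_segment (node M i) (node M j)"
      unfolding in_segment(2) using ne by blast
    then show "0 < f (edge_point M (i, j) s)" by (rule pos)
  qed
  with L show ?thesis by (simp add: edge_average_def)
qed

lemma open_edge_subset_domain:
  assumes e: "(i, j) \<in> set (edges M)"
    and int: "i \<in> set (interior_nodes \<Omega> M) \<or> j \<in> set (interior_nodes \<Omega> M)"
  shows "open_segment (node M i) (node M j) \<subseteq> \<Omega>"
proof -
  have E: "i < num_nodes M" "j < num_nodes M" "i \<noteq> j"
    "closed_segment (node M i) (node M j) \<in> complex M" using e edge_iff[of i j] by auto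
  have "node M i \<in> \<Omega> \<or> node M j \<in> \<Omega>"
    using int interior_nodes_iff[of i] interior_nodes_iff[of j] by blast
  then have "rel_interior (closed_segment (node M i) (node M j)) \<subseteq> \<Omega>"
    using rel_interior_subset_domain[OF E(4)] by auto
  then show ?thesis
    using node_inj[OF E(1,2)] E(3) by (simp add: rel_interior_closed_segment)
qed

end

context dual_domain_mesh
begin

definition edge_weight :: "(real^3 \<Rightarrow> real) \<Rightarrow> (real^3 \<Rightarrow> real) \<Rightarrow> nat \<times> nat \<Rightarrow> real" where
  "edge_weight \<alpha> \<phi> e = planar_area (dual_face V e) * edge_average M \<alpha> e *
     (1 / edge_average M (\<lambda>x. exp (\<phi> x)) e) * (1 / edge_length M e)"

lemma weight_mat_eq:
  assumes "\<forall>e\<in>set (edges M). integrable_on_edge M (\<lambda>x. exp (\<phi> x)) e"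
  shows "weight_mat M V \<alpha> \<phi> = mat_diag (num_edges M) (\<lambda>k. edge_weight \<alpha> \<phi> (edges M ! k))"
proof -
  have avg: "0 < edge_average M (\<lambda>x. exp (\<phi> x)) (edges M ! k)"
    and len: "0 < edge_length M (edges M ! k)" if k: "k < num_edges M" for k
  proof -
    obtain i j where e: "edges M ! k = (i, j)" by (cases "edges M ! k")
    then have "(i, j) \<in> set (edges M)" using nth_mem[OF k] by simp
    then show "0 < edge_average M (\<lambda>x. exp (\<phi> x)) (edges M ! k)" "0 < edge_length M (edges M ! k)"
      unfolding e using assms by (auto intro: edge_average_pos edge_length_pos)
  qed
  have "minv (edge_diag M (edge_average M (\<lambda>x. exp (\<phi> x)))) =
      mat_diag (num_edges M) (\<lambda>k. 1 / edge_average M (\<lambda>x. exp (\<phi> x)) (edges M ! k))"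
    unfolding edge_diag_def by (rule minv_mat_diag) (use avg in force)
  moreover have "minv (edge_diag M (edge_length M)) =
      mat_diag (num_edges M) (\<lambda>k. 1 / edge_length M (edges M ! k))"
    unfolding edge_diag_def by (rule minv_mat_diag) (use len in force)
  ultimately show ?thesis
    by (simp only: weight_mat_def edge_diag_def mat_diag_diag edge_weight_def)
qed

lemma edge_weight_pos:
  assumes e: "(i, j) \<in> set (edges M)"
    and int: "i \<in> set (interior_nodes \<Omega> M) \<or> j \<in> set (interior_nodes \<Omega> M)"
    and \<alpha>: "\<forall>x\<in>\<Omega>. \<alpha> x > 0"
    and integrable: "integrable_on_edge M \<alpha> (i, j)" "integrable_on_edge M (\<lambda>x. exp (\<phi> x)) (i, j)"
  shows "0 < edge_weight \<alpha> \<phi> (i, j)"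
proof -
  have "0 < planar_area (dual_face V (i, j))" by (rule dual_face_area_pos[OF e int])
  moreover have "0 < edge_average M \<alpha> (i, j)"
    using \<alpha> open_edge_subset_domain[OF e int] by (intro edge_average_pos[OF e integrable(1)]) blast
  moreover have "0 < edge_average M (\<lambda>x. exp (\<phi> x)) (i, j)"
    by (rule edge_average_pos[OF e integrable(2)]) simp
  ultimately show ?thesis using edge_length_pos[OF e] by (simp add: edge_weight_def)
qed

lemma stiffness_mat_eq:
  assumes "\<forall>e\<in>set (edges M). integrable_on_edge M (\<lambda>x. exp (\<phi> x)) e"
  shows "stiffness_mat \<Omega> M V \<alpha> \<phi> \<gamma> =
    mat_diag (length (interior_nodes \<Omega> M)) (\<lambda>r. 1 / measure lebesgue (V (interior_nodes \<Omega> M ! r))) *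
      transpose_mat (incidence_mat \<Omega> M) *
      mat_diag (num_edges M) (\<lambda>k. edge_weight \<alpha> \<phi> (edges M ! k)) * incidence_mat \<Omega> M *
      mat_diag (length (interior_nodes \<Omega> M)) (\<lambda>r. exp (\<phi> (node M (interior_nodes \<Omega> M ! r)))) +
    mat_diag (length (interior_nodes \<Omega> M)) (\<lambda>r. \<gamma> (node M (interior_nodes \<Omega> M ! r)))"
proof -
  let ?I = "interior_nodes \<Omega> M"
  have "minv (node_diag \<Omega> M (\<lambda>i. measure lebesgue (V i))) =
      mat_diag (length ?I) (\<lambda>r. 1 / measure lebesgue (V (?I ! r)))"
    unfolding node_diag_def
  proof (rule minv_mat_diag)
    fix r assume "r < length ?I"
    then show "measure lebesgue (V (?I ! r)) \<noteq> 0"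
      using cell_volume_pos[OF nth_mem[of r ?I]] by simp
  qed
  then show ?thesis
    unfolding stiffness_mat_def weight_mat_eq[OF assms] by (simp only: node_diag_def)
qed

text \<open>
  The maximum principle is applied with \<open>v = 1 / u = exp (- \<phi>)\<close> and the sum of the coordinates as
  the height. The quantities \<open>b k\<close> are the row sums of the incidence matrix, so that
  \<open>A v\<close> has the entries \<open>d r * (\<Sum>k. G (k, r) * w k * b k) + g r / u r\<close>.
\<close>

lemma stiffness_mat_inverse_nonneg:
  assumes \<alpha>: "\<forall>x\<in>\<Omega>. \<alpha> x > 0" and \<gamma>: "\<forall>x\<in>\<Omega>. \<gamma> x \<ge> 0"
    and integrable: "\<forall>e\<in>set (edges M). integrable_on_edge M \<alpha> e \<and> integrable_on_edge M (\<lambda>x. exp (\<phi> x)) e"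
  defines "A \<equiv> stiffness_mat \<Omega> M V \<alpha> \<phi> \<gamma>" and "n \<equiv> length (interior_nodes \<Omega> M)"
  shows "A \<in> carrier_mat n n"
    and "\<And>r s. r < n \<Longrightarrow> s < n \<Longrightarrow> r \<noteq> s \<Longrightarrow> A $$ (r, s) \<le> 0"
    and "\<And>x. x \<in> carrier_vec n \<Longrightarrow> 0\<^sub>v n \<le> A *\<^sub>v x \<Longrightarrow> 0\<^sub>v n \<le> x"
proof -
  let ?I = "interior_nodes \<Omega> M" and ?m = "num_edges M" and ?G = "incidence_mat \<Omega> M"
  define w where "w = (\<lambda>k. edge_weight \<alpha> \<phi> (edges M ! k))"
  define d where "d = (\<lambda>r. 1 / measure lebesgue (V (?I ! r)))"
  define u where "u = (\<lambda>r. exp (\<phi> (node M (?I ! r))))"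
  define g where "g = (\<lambda>r. \<gamma> (node M (?I ! r)))"
  have G: "?G \<in> carrier_mat ?m n" by (simp add: incidence_mat_def n_def)
  have A_eq: "A = mat_diag n d * transpose_mat ?G * mat_diag ?m w * ?G * mat_diag n u + mat_diag n g"
    unfolding A_def n_def d_def w_def u_def g_def using integrable by (intro stiffness_mat_eq) blast
  have A: "A \<in> carrier_mat n n" unfolding A_eq by simp
  show "A \<in> carrier_mat n n" by (rule A)
  have entry: "A $$ (r, s) = d r * (\<Sum>k<?m. ?G $$ (k, r) * w k * ?G $$ (k, s)) * u s + (if r = s then g r else 0)"
    if "r < n" "s < n" for r s
    unfolding A_eq by (rule weighted_Laplacian_entry[OF G that])
  have I_mem: "?I ! r \<in> set ?I" if "r < n" for r using that by (simp add: n_def)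
  have I_inj: "?I ! r = ?I ! s \<longleftrightarrow> r = s" if "r < n" "s < n" for r s
    using that by (simp add: n_def nth_eq_iff_index_eq interior_nodes_def)
  have d_pos: "0 < d r" if "r < n" for r
    using cell_volume_pos[OF I_mem[OF that]] by (simp add: d_def)
  have u_pos: "0 < u r" for r by (simp add: u_def)
  have g_nonneg: "0 \<le> g r" if "r < n" for r
    using \<gamma> I_mem[OF that] interior_nodes_iff[of "?I ! r"] by (simp add: g_def)
  have edge: "(i, j) \<in> set (edges M)" "i \<noteq> j" if "k < ?m" "edges M ! k = (i, j)" for i j k
  proof -
    show "(i, j) \<in> set (edges M)" using nth_mem[OF that(1)] that(2) by simp
    then show "i \<noteq> j" using edge_iff[of i j] by simp
  qed
  have w_pos: "0 < w k" if k: "k < ?m" "edges M ! k = (i, j)" and "i \<in> set ?I \<or> j \<in> set ?I" for i j k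
    unfolding w_def k(2) using edge[OF k] that(3) \<alpha> integrable by (intro edge_weight_pos) auto
  define b where "b k = (\<Sum>s<n. ?G $$ (k, s))" for k
  have G_ix: "?G $$ (k, r) = (if ?I ! r = i then - 1 else if ?I ! r = j then 1 else 0)"
    if "k < ?m" "edges M ! k = (i, j)" "r < n" for i j k r
    using incidence_entry that by (simp add: n_def)
  have b_ix: "b k = of_bool (j \<in> set ?I) - of_bool (i \<in> set ?I)" if "k < ?m" "edges M ! k = (i, j)" for i j k
    unfolding b_def n_def by (rule incidence_row_sum[OF that edge(2)[OF that]])
  have off_term: "?G $$ (k, r) * w k * ?G $$ (k, s) \<le> 0" if k: "k < ?m" and rs: "r < n" "s < n" "r \<noteq> s" for k r s
  proof -
    obtain i j where e: "edges M ! k = (i, j)" by (cases "edges M ! k")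
    have "?I ! r \<noteq> ?I ! s" using I_inj rs by simp
    then show ?thesis
      using G_ix[OF k e rs(1)] G_ix[OF k e rs(2)] w_pos[OF k e] I_mem[OF rs(1)] I_mem[OF rs(2)]
      by (auto simp: less_imp_le)
  qed
  show off: "A $$ (r, s) \<le> 0" if "r < n" "s < n" "r \<noteq> s" for r s
  proof -
    have "(\<Sum>k<?m. ?G $$ (k, r) * w k * ?G $$ (k, s)) \<le> 0"
      using off_term that by (intro sum_nonpos) simp
    then show ?thesis
      using entry[OF that(1,2)] that(3) d_pos[OF that(1)] u_pos[of s]
      by (simp add: mult_nonneg_nonpos mult_nonpos_nonneg less_imp_le)
  qed
  have row: "(\<Sum>s<n. A $$ (r, s) * (1 / u s)) = d r * (\<Sum>k<?m. ?G $$ (k, r) * w k * b k) + g r / u r"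
    if r: "r < n" for r
  proof -
    have "(\<Sum>s<n. A $$ (r, s) * (1 / u s)) =
        (\<Sum>s<n. d r * (\<Sum>k<?m. ?G $$ (k, r) * w k * ?G $$ (k, s)) + (if s = r then g r / u r else 0))"
      using entry[OF r] u_pos by (intro sum.cong) (auto simp: field_simps less_imp_neq[symmetric])
    also have "\<dots> = d r * (\<Sum>s<n. \<Sum>k<?m. ?G $$ (k, r) * w k * ?G $$ (k, s)) + g r / u r"
      using r by (simp add: sum.distrib sum_distrib_left)
    also have "(\<Sum>s<n. \<Sum>k<?m. ?G $$ (k, r) * w k * ?G $$ (k, s)) = (\<Sum>k<?m. ?G $$ (k, r) * w k * b k)"
      unfolding b_def sum_distrib_left by (rule sum.swap)
    finally show ?thesis .
  qed
  have row_term: "0 \<le> ?G $$ (k, r) * w k * b k" if k: "k < ?m" and r: "r < n" for k r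
  proof -
    obtain i j where e: "edges M ! k = (i, j)" by (cases "edges M ! k")
    show ?thesis
      using G_ix[OF k e r] b_ix[OF k e] w_pos[OF k e] I_mem[OF r] edge(2)[OF k e]
      by (auto simp: less_imp_le)
  qed
  have row_nonneg: "0 \<le> (\<Sum>s<n. A $$ (r, s) * (1 / u s))" if r: "r < n" for r
  proof -
    have "0 \<le> (\<Sum>k<?m. ?G $$ (k, r) * w k * b k)"
      using row_term[OF _ r] by (intro sum_nonneg) simp
    then show ?thesis
      unfolding row[OF r] using d_pos[OF r] g_nonneg[OF r] u_pos[of r] by (simp add: less_imp_le)
  qed
  define h where "h = (\<lambda>r. inner (1 :: real^3) (node M (?I ! r)))"
  have chain: "0 < (\<Sum>s<n. A $$ (r, s) * (1 / u s)) \<or> (\<exists>s<n. A $$ (r, s) < 0 \<and> h r < h s)"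
    if r: "r < n" for r
  proof -
    let ?i = "?I ! r"
    have "?i < num_nodes M" "node M ?i \<in> \<Omega>" using I_mem[OF r] interior_nodes_iff[of ?i] by auto
    then obtain j where j: "(?i, j) \<in> set (edges M) \<or> (j, ?i) \<in> set (edges M)"
      "inner 1 (node M ?i) < inner 1 (node M j)"
      using interior_node_higher_neighbour[of ?i 1] by auto
    then obtain p q where "(p, q) \<in> set (edges M)" and pq: "p = ?i \<and> q = j \<or> p = j \<and> q = ?i"
      by blast
    then obtain k where k: "k < ?m" "edges M ! k = (p, q)" unfolding in_set_conv_nth by blast
    have w: "0 < w k" using w_pos[OF k] pq I_mem[OF r] by auto
    show ?thesis
    proof (cases "j \<in> set ?I")
      case True
      then obtain s where s: "s < n" "?I ! s = j" by (auto simp: in_set_conv_nth n_def)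
      have rs: "r \<noteq> s" using s j(2) by auto
      have "?G $$ (k, r) * w k * ?G $$ (k, s) < 0"
        using G_ix[OF k r] G_ix[OF k s(1)] s(2) pq w edge(2)[OF k] by auto
      then have "0 < (\<Sum>k<?m. - (?G $$ (k, r) * w k * ?G $$ (k, s)))"
        using off_term[OF _ r s(1) rs] k(1) by (intro sum_pos2[of _ k]) auto
      then have "(\<Sum>k<?m. ?G $$ (k, r) * w k * ?G $$ (k, s)) < 0" by (simp add: sum_negf)
      then have "A $$ (r, s) < 0"
        using entry[OF r s(1)] rs d_pos[OF r] u_pos[of s] by (simp add: mult_pos_neg mult_neg_pos)
      then show ?thesis using s j(2) by (auto simp: h_def)
    next
      case False
      have "0 < ?G $$ (k, r) * w k * b k"
        using G_ix[OF k r] b_ix[OF k] pq w False I_mem[OF r] edge(2)[OF k] by auto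
      then have "0 < (\<Sum>k<?m. ?G $$ (k, r) * w k * b k)"
        using row_term[OF _ r] k(1) by (intro sum_pos2[of _ k]) auto
      then have "0 < (\<Sum>s<n. A $$ (r, s) * (1 / u s))"
        unfolding row[OF r] using d_pos[OF r] g_nonneg[OF r] u_pos[of r]
        by (intro add_pos_nonneg mult_pos_pos) (auto simp: less_imp_le)
      then show ?thesis ..
    qed
  qed
  show "0\<^sub>v n \<le> x" if "x \<in> carrier_vec n" "0\<^sub>v n \<le> A *\<^sub>v x" for x
    using u_pos by (intro chained_Z_matrix_inverse_nonneg[OF A off _ row_nonneg chain that]) auto
qed

end

theorem theorem4p14:
  fixes \<Omega> :: "(real^3) set"
    and \<alpha> \<gamma> \<phi> :: "real^3 \<Rightarrow> real"
    and \<beta> :: "real^3 \<Rightarrow> real^3"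
    and M :: mesh
    and c :: "(real^3) set \<Rightarrow> real^3"
    and V :: "nat \<Rightarrow> (real^3) set"
  assumes "bounded_polyhedral_domain \<Omega>"
    and "simplicial_mesh \<Omega> M"
    and "dual_mesh \<Omega> M c V"
    and "nondegenerate M c"
    and "\<forall>x\<in>\<Omega>. \<alpha> x > 0"
    and "\<forall>x\<in>\<Omega>. \<gamma> x \<ge> 0"
    and "\<forall>x\<in>\<Omega>. GDERIV \<phi> x :> (1 / \<alpha> x) *\<^sub>R \<beta> x"
    and "\<forall>e\<in>set (edges M). integrable_on_edge M \<alpha> e \<and> integrable_on_edge M (\<lambda>x. exp (\<phi> x)) e"
  shows "nonsingular_M_matrix (stiffness_mat \<Omega> M V \<alpha> \<phi> \<gamma>)
       \<and> monotone_mat (stiffness_mat \<Omega> M V \<alpha> \<phi> \<gamma>)"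
proof -
  interpret dual_domain_mesh \<Omega> M c V
    using assms(1-4) by unfold_locales (auto simp: bounded_polyhedral_domain_def)
  note inv = stiffness_mat_inverse_nonneg[OF assms(5,6,8)]
  show ?thesis
    using nonsingular_M_matrixI[OF inv] monotone_matI[OF inv(1,3)] by blast
qed

end
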